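(* Let $\alpha:[0,\infty)\to(0,\infty)$ be measurable and locally integrable, let $X$ be the solution of $dX_t=-\alpha(t)X_t\,dt+dW_t$, $X_0=0$, and let $\mathcal L_t^x$ be its local time. Fix $R>0$ and $t>0$. Then for every exponent $\lambda\in(0,1/2)$ there is an almost surely finite positive random constant $C_{\lambda,t,R}$ such that (for a suitable modification of $(\mathcal L_t^x)_{x\in\mathbb R}$), almost surely, $$|\mathcal L_t^x-\mathcal L_t^y|\le C_{\lambda,t,R}\,|x-y|^{\lambda}\qquad\text{for all }x,y\in[-R,R].$$
   Context: $W=(W_t)_{t\ge0}$ is a standard one-dimensional Brownian motion on a complete filtered probability space, and $X_t=\int_0^t\exp(-\int_s^t\alpha(u)\,du)\,dW_s$ (continuous version). The local time at level $x$, formally $\mathcal L_t^x=\int_0^t\delta(X_r-x)\,dr$ with $\delta$ the Dirac delta at $0$, is the limit in $L^2$ as $\varepsilon\to0+$ of $\int_0^t p_\varepsilon(X_r-x)\,dr$, where $p_\varepsilon(y)=\frac1{\sqrt{2\pi\varepsilon}}e^{-y^2/(2\varepsilon)}$. *)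

theory Defs
  imports "HOL-Probability.Probability"
begin

text \<open>Time runs through the nonnegative reals: processes and filtrations are indexed by
  \<^typ>\<open>real\<close>, and nothing is required of them at negative times.\<close>

locale complete_filtered_prob_space = prob_space M + complete_measure M
  for M :: "'a measure" +
  fixes F :: "real \<Rightarrow> 'a measure"
  assumes subalg: "\<And>t. 0 \<le> t \<Longrightarrow> subalgebra M (F t)"
    and filt_mono: "\<And>s t. 0 \<le> s \<Longrightarrow> s \<le> t \<Longrightarrow> sets (F s) \<subseteq> sets (F t)"
    and null_sets_F0: "null_sets M \<subseteq> sets (F 0)"

locale std_brownian_motion = complete_filtered_prob_space M F
  for M :: "'a measure" and F :: "real \<Rightarrow> 'a measure" +
  fixes W :: "real \<Rightarrow> 'a \<Rightarrow> real"
  assumes adapted: "\<And>t. 0 \<le> t \<Longrightarrow> W t \<in> borel_measurable (F t)"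
    and start: "AE \<omega> in M. W 0 \<omega> = 0"
    and increment_normal: "\<And>s t. 0 \<le> s \<Longrightarrow> s < t \<Longrightarrow>
          distributed M lborel (\<lambda>\<omega>. W t \<omega> - W s \<omega>) (normal_density 0 (sqrt (t - s)))"
    and increment_indep: "\<And>s t. 0 \<le> s \<Longrightarrow> s < t \<Longrightarrow>
          indep_set (sets (F s)) {(\<lambda>\<omega>. W t \<omega> - W s \<omega>) -` A \<inter> space M | A. A \<in> sets borel}"
    and continuous_paths: "AE \<omega> in M. continuous_on {0..} (\<lambda>t. W t \<omega>)"

text \<open>The equation \<open>dX\<^sub>t = - \<alpha>(t) X\<^sub>t dt + dW\<^sub>t\<close>, \<open>X\<^sub>0 = 0\<close>, in integral form.  The noise is
  additive, so the stochastic integral of \<open>dW\<close> over \<open>[0,t]\<close> is \<open>W\<^sub>t\<close>.  The drift integral is a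
  genuine one, because paths are continuous and \<open>\<alpha>\<close> will be locally integrable.\<close>

definition solves_OU ::
  "'a measure \<Rightarrow> (real \<Rightarrow> 'a measure) \<Rightarrow> (real \<Rightarrow> real) \<Rightarrow> (real \<Rightarrow> 'a \<Rightarrow> real) \<Rightarrow>
     (real \<Rightarrow> 'a \<Rightarrow> real) \<Rightarrow> bool" where
  "solves_OU M F \<alpha> W X \<longleftrightarrow>
     (\<forall>t\<ge>0. X t \<in> borel_measurable (F t)) \<and>
     (AE \<omega> in M. continuous_on {0..} (\<lambda>t. X t \<omega>)) \<and>
     (AE \<omega> in M. X 0 \<omega> = 0) \<and>
     (AE \<omega> in M. \<forall>t\<ge>0. X t \<omega> = - (LINT s:{0..t}|lebesgue. \<alpha> s * X s \<omega>) + W t \<omega>)"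

definition heat_kernel :: "real \<Rightarrow> real \<Rightarrow> real" where
  "heat_kernel \<epsilon> y = 1 / sqrt (2 * pi * \<epsilon>) * exp (- y\<^sup>2 / (2 * \<epsilon>))"

definition tendsto_L2 ::
  "'a measure \<Rightarrow> ('i \<Rightarrow> 'a \<Rightarrow> real) \<Rightarrow> ('a \<Rightarrow> real) \<Rightarrow> 'i filter \<Rightarrow> bool" where
  "tendsto_L2 M f g G \<longleftrightarrow>
     (\<forall>\<^sub>F i in G. f i \<in> borel_measurable M \<and> integrable M (\<lambda>\<omega>. (f i \<omega>)\<^sup>2)) \<and>
     g \<in> borel_measurable M \<and> integrable M (\<lambda>\<omega>. (g \<omega>)\<^sup>2) \<and>
     ((\<lambda>i. LINT \<omega>|M. (f i \<omega> - g \<omega>)\<^sup>2) \<longlongrightarrow> 0) G"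

text \<open>\<open>L t x\<close> is a version of the local time at level \<open>x\<close>; as an \<open>L\<^sup>2\<close> limit it is determined
  only up to a null set, separately for each \<open>t\<close> and \<open>x\<close>.\<close>

definition is_local_time ::
  "'a measure \<Rightarrow> (real \<Rightarrow> 'a \<Rightarrow> real) \<Rightarrow> (real \<Rightarrow> real \<Rightarrow> 'a \<Rightarrow> real) \<Rightarrow> bool" where
  "is_local_time M X L \<longleftrightarrow>
     (\<forall>t\<ge>0. \<forall>x. tendsto_L2 M (\<lambda>\<epsilon> \<omega>. LINT r:{0..t}|lborel. heat_kernel \<epsilon> (X r \<omega> - x))
                   (L t x) (at_right 0))"

definition is_modification ::
  "'a measure \<Rightarrow> ('i \<Rightarrow> 'a \<Rightarrow> real) \<Rightarrow> ('i \<Rightarrow> 'a \<Rightarrow> real) \<Rightarrow> bool" where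
  "is_modification M Y Z \<longleftrightarrow>
     (\<forall>i. Z i \<in> borel_measurable M \<and> (AE \<omega> in M. Z i \<omega> = Y i \<omega>))"

end

theory Submission
  imports Defs
begin

text \<open>
  The process \<open>X\<close> is Markov with Gaussian transition kernels: \<open>X\<^sub>s - m(r,s) X\<^sub>r\<close> is independent of the past
  and normal with variance at least \<open>c (s - r)\<close>, as one sees by approximating it by weighted sums of
  Brownian increments. With \<open>f = p\<^sub>\<epsilon>(\<cdot> - x) - p\<^sub>\<epsilon>(\<cdot> - y)\<close>, the moments of the integral of \<open>f(X\<^sub>s)\<close> over \<open>[0,t]\<close> are
  iterated potentials, obtained by integrating backwards in time one variable at a time. One potential of
  a bounded function is \<open>\<theta>\<close>-Hoelder in space for every \<open>\<theta> < 1\<close>, because the kernel increments are bounded by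
  \<open>\<bar>x - y\<bar>\<^sup>\<theta> (s - r)\<^bsup>-(1+\<theta>)/2\<^esup>\<close>, which is integrable in time; a second one exploits the
  cancellation in \<open>f\<close> and gains the factor \<open>\<bar>x - y\<bar>\<^sup>\<theta>\<close>. Hence the moment of order \<open>2 k\<close> is
  at most a constant times \<open>\<bar>x - y\<bar>\<close> to the power \<open>k \<theta>\<close>, uniformly in \<open>\<epsilon>\<close>. Fatou's lemma
  transfers this to the local time, and the Kolmogorov-Chentsov criterion gives every exponent below
  \<open>\<theta> / 2 - 1 / (2 k)\<close>.
\<close>

section \<open>The Kolmogorov-Chentsov criterion\<close>

text \<open>Estimating \<open>heat_diff\<close> in absolute value loses all dependence on |x - y|.
  Moving the difference onto the functions next to it yields a factor |x - y|^\<theta>, but only if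
  those functions are \<theta>-Hoelder, and the kernel then costs the singularity (s - r)^(-(1 +
  \<theta>)/2), integrable only for \<theta> < 1. A gain uses up the Hoelder regularity of the inner
  potential, and another integration is spent on restoring it, so that every second integration
  contributes. Hence order 2 k gives the power k \<theta>, and the exponents below \<theta>/2 - 1/(2
  k) exhaust (0, 1/2) as \<theta> tends to 1 and k to infinity. The iterated structure comes from
  differentiating a power of the integral of f(X_s) over [r, t] in its lower limit. Bounded weights
  known at time r are carried along, so that the Markov property applies one step at a time. The sup
  norm of f explodes as \<epsilon> tends to 0; it only justifies exchanging integrals, while the
  estimates use the L1 norm of f, at most 2. The modification is a limit along dyadic points that
  involves no exponent, so a single one serves every \<lambda>.\<close>

definition dyadic_floor :: "nat \<Rightarrow> real \<Rightarrow> real" where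
  "dyadic_floor n x = real_of_int \<lfloor>2 ^ n * x\<rfloor> / 2 ^ n"

text \<open>The candidate modification: it uses only values at dyadic points. \<open>lim\<close> is
  total, so divergent paths also receive some value.\<close>

definition dyadic_limit :: "(real \<Rightarrow> real) \<Rightarrow> real \<Rightarrow> real" where
  "dyadic_limit v x = lim (\<lambda>n. v (dyadic_floor n x))"

text \<open>Comparison with a geometric series. The induction carries the finite sum with
  \<open>q ^ n - q ^ (n + k)\<close>, since the cruder bound with \<open>q ^ n\<close> alone is not
  inductive.\<close>

lemma geometric_increments_limit:
  fixes f :: "nat \<Rightarrow> real"
  assumes inc: "\<And>n. \<bar>f (Suc n) - f n\<bar> \<le> C * q ^ Suc n"
    and q: "0 < q" "q < 1" and C: "0 \<le> C"
  shows "f \<longlonglongrightarrow> lim f" and "\<bar>lim f - f n\<bar> \<le> C * q ^ n / (1 - q)"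
proof -
  have step: "\<bar>f (n + k) - f n\<bar> \<le> C * (q ^ n - q ^ (n + k)) / (1 - q)" for n k
  proof (induction k)
    case (Suc k)
    have "\<bar>f (n + Suc k) - f n\<bar> \<le> \<bar>f (Suc (n + k)) - f (n + k)\<bar> + \<bar>f (n + k) - f n\<bar>"
      by simp
    also have "\<dots> \<le> C * q ^ Suc (n + k) + C * (q ^ n - q ^ (n + k)) / (1 - q)"
      using inc[of "n + k"] Suc by linarith
    also have "\<dots> \<le> C * q ^ (n + k) + C * (q ^ n - q ^ (n + k)) / (1 - q)"
      using q C by (intro add_right_mono mult_left_mono) (auto intro!: mult_left_le_one_le)
    also have "\<dots> = C * (q ^ n - q ^ (n + Suc k)) / (1 - q)"
      using q by (simp add: field_simps)
    finally show ?case .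
  qed simp
  have bd: "\<bar>f m - f n\<bar> \<le> C * q ^ n / (1 - q)" if "n \<le> m" for m n
  proof -
    obtain k where k: "m = n + k" using \<open>n \<le> m\<close> le_Suc_ex by blast
    have "C * (q ^ n - q ^ (n + k)) / (1 - q) \<le> C * q ^ n / (1 - q)"
      using q C by (intro divide_right_mono mult_left_mono) auto
    with step[of n k] show ?thesis unfolding k by (rule order_trans)
  qed
  have "(\<lambda>n. C * q ^ n / (1 - q)) \<longlonglongrightarrow> C * 0 / (1 - q)"
    using q by (intro tendsto_intros) auto
  hence lim0: "(\<lambda>n. C * q ^ n / (1 - q)) \<longlonglongrightarrow> 0" by simp
  have "Cauchy f"
  proof (rule metric_CauchyI)
    fix e :: real assume "e > 0"
    then obtain N where N: "C * q ^ N / (1 - q) < e / 2"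
      using order_tendstoD(2)[OF lim0, of "e / 2"] by (auto simp: eventually_sequentially)
    show "\<exists>M. \<forall>m\<ge>M. \<forall>n\<ge>M. dist (f m) (f n) < e"
    proof (intro exI allI impI)
      fix m n assume "m \<ge> N" "n \<ge> N"
      then show "dist (f m) (f n) < e"
        using bd[of N m] bd[of N n] N unfolding dist_real_def by linarith
    qed
  qed
  then show L: "f \<longlonglongrightarrow> lim f"
    using Cauchy_convergent_iff convergent_LIMSEQ_iff by blast
  show "\<bar>lim f - f n\<bar> \<le> C * q ^ n / (1 - q)"
    by (rule LIMSEQ_le_const2[OF tendsto_rabs[OF tendsto_diff[OF L tendsto_const]]])
      (use bd in blast)
qed

text \<open>Allowing \<open>i = 2 ^ n\<close> covers the right endpoint x = 1.\<close>

lemma dyadic_floor_grid: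
  assumes "0 \<le> x" "x \<le> 1"
  obtains i :: nat where "\<lfloor>2 ^ n * x\<rfloor> = int i" "i \<le> 2 ^ n"
    "dyadic_floor n x = real i / 2 ^ n"
proof -
  have "0 \<le> \<lfloor>2 ^ n * x\<rfloor>" using assms by simp
  moreover have "\<lfloor>2 ^ n * x\<rfloor> \<le> 2 ^ n"
    using assms floor_mono[of "2 ^ n * x" "2 ^ n"] by (simp add: mult_left_le)
  ultimately show ?thesis
    by (intro that[of "nat \<lfloor>2 ^ n * x\<rfloor>"]) (auto simp: dyadic_floor_def nat_le_iff)
qed

lemma dyadic_floor_mem: "x \<in> {0..1} \<Longrightarrow> dyadic_floor n x \<in> {0..1}"
  by (rule dyadic_floor_grid[of x n]) auto

lemma dyadic_floor_dist: "\<bar>dyadic_floor n x - x\<bar> \<le> 1 / 2 ^ n"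
proof -
  have "\<bar>real_of_int \<lfloor>2 ^ n * x\<rfloor> - 2 ^ n * x\<bar> \<le> 1" by linarith
  then have "\<bar>(real_of_int \<lfloor>2 ^ n * x\<rfloor> - 2 ^ n * x) / 2 ^ n\<bar> \<le> 1 / 2 ^ n"
    unfolding abs_divide by (intro divide_mono) auto
  then show ?thesis by (simp add: dyadic_floor_def diff_divide_distrib)
qed

section \<open>Dyadic chaining for a single function\<close>

context
  fixes v :: "real \<Rightarrow> real" and C \<gamma> q :: real
  assumes \<gamma>: "0 < \<gamma>" and q: "q = 2 powr (- \<gamma>)" and C: "0 \<le> C"
    and inc: "\<And>n i. i < 2 ^ n \<Longrightarrow> \<bar>v (real (Suc i) / 2 ^ n) - v (real i / 2 ^ n)\<bar> \<le> C * q ^ n"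
begin

lemma q_unit: "0 < q" "q < 1"
  using \<gamma> by (auto simp: q powr_less_one)

text \<open>Halving the mesh leaves the floor in place or moves it to the new midpoint on its right,
  hence across one interval of level \<open>Suc n\<close>.\<close>

lemma dyadic_refine:
  assumes "x \<in> {0..1}"
  shows "\<bar>v (dyadic_floor (Suc n) x) - v (dyadic_floor n x)\<bar> \<le> C * q ^ Suc n"
proof -
  obtain i where i: "\<lfloor>2 ^ n * x\<rfloor> = int i" "i \<le> 2 ^ n" "dyadic_floor n x = real i / 2 ^ n"
    using dyadic_floor_grid[of x n] assms by auto
  obtain j where j: "\<lfloor>2 ^ Suc n * x\<rfloor> = int j" "j \<le> 2 ^ Suc n"
    "dyadic_floor (Suc n) x = real j / 2 ^ Suc n"
    using dyadic_floor_grid[of x "Suc n"] assms by auto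
  have "j = 2 * i \<or> j = Suc (2 * i)"
  proof -
    have "real i \<le> 2 ^ n * x" "2 ^ n * x < real i + 1" "real j \<le> 2 * (2 ^ n * x)"
      "2 * (2 ^ n * x) < real j + 1"
      using i(1) j(1) by (simp_all add: floor_eq_iff mult.assoc)
    then have "real (2 * i) < real (j + 1)" "real j < real (2 * i + 2)" by simp_all
    then show ?thesis by linarith
  qed
  then show ?thesis
  proof
    assume "j = 2 * i"
    then have "dyadic_floor (Suc n) x = dyadic_floor n x" using i j by simp
    then show ?thesis using C q_unit by simp
  next
    assume ji: "j = Suc (2 * i)"
    have "dyadic_floor n x = real (2 * i) / 2 ^ Suc n" using i by simp
    then show ?thesis using inc[of "2 * i" "Suc n"] ji j by simp
  qed
qed

lemma dyadic_limit_tendsto: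
  assumes "x \<in> {0..1}"
  shows "(\<lambda>n. v (dyadic_floor n x)) \<longlonglongrightarrow> dyadic_limit v x"
    and "\<bar>dyadic_limit v x - v (dyadic_floor n x)\<bar> \<le> C * q ^ n / (1 - q)"
  using geometric_increments_limit[OF dyadic_refine[OF assms] q_unit C]
  by (simp_all add: dyadic_limit_def)

text \<open>At the scale of |x - y| the two dyadic floors coincide or are neighbours. The constant
  collects two tails \<open>1 / (1 - q)\<close>, one jump, and a factor \<open>1 / q\<close> for
  passing from \<open>q ^ m\<close> to \<open>q ^ Suc m\<close>.\<close>

lemma dyadic_limit_Holder:
  assumes x: "x \<in> {0..1}" and y: "y \<in> {0..1}"
  shows "\<bar>dyadic_limit v x - dyadic_limit v y\<bar> \<le> C * ((2 / (1 - q) + 1) / q) * \<bar>x - y\<bar> powr \<gamma>"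
  using x y
proof (induction x y rule: linorder_wlog)
  case (sym a b)
  then show ?case by (simp add: abs_minus_commute)
next
  case (le x y)
  show ?case
  proof (cases "x = y")
    case False
    define h where "h = y - x"
    have h: "0 < h" "h \<le> 1" using le False by (auto simp: h_def)
    \<comment> \<open>\<open>m\<close> is the level with
      \<open>2 ^ m * h \<le> 1 < 2 ^ Suc m * h\<close>: the first inequality keeps the floors
      adjacent, the second gives \<open>q ^ Suc m \<le> h powr \<gamma>\<close>.\<close>
    define m where "m = nat \<lfloor>- log 2 h\<rfloor>"
    have l0: "0 \<le> - log 2 h" using h by (simp add: log_le_zero_cancel_iff)
    then have mm: "real m \<le> - log 2 h" "- log 2 h < real m + 1"
      by (simp_all add: m_def)
    have "2 powr (real m) \<le> 2 powr (- log 2 h)" using mm by simp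
    also have "\<dots> = 1 / h" using h by (simp add: powr_minus_divide)
    finally have hm: "2 ^ m * h \<le> 1" using h by (simp add: powr_realpow field_simps)
    have "q ^ Suc m = 2 powr (- \<gamma> * (real m + 1))"
      by (simp only: q powr_realpow[symmetric] powr_powr powr_gt_zero) (simp add: algebra_simps)
    also have "\<dots> \<le> 2 powr (\<gamma> * log 2 h)"
      using mult_left_mono[of "- log 2 h" "real m + 1" \<gamma>] mm \<gamma> by (simp add: algebra_simps)
    also have "\<dots> = h powr \<gamma>" using h by (simp add: powr_powr[symmetric] mult.commute[of \<gamma>])
    finally have qh: "q ^ Suc m \<le> h powr \<gamma>" .
    obtain i where i: "\<lfloor>2 ^ m * x\<rfloor> = int i" "i \<le> 2 ^ m" "dyadic_floor m x = real i / 2 ^ m"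
      using dyadic_floor_grid[of x m] le by auto
    obtain j where j: "\<lfloor>2 ^ m * y\<rfloor> = int j" "j \<le> 2 ^ m" "dyadic_floor m y = real j / 2 ^ m"
      using dyadic_floor_grid[of y m] le by auto
    have "j = i \<or> j = Suc i"
    proof -
      have "real i \<le> 2 ^ m * x" "2 ^ m * x < real i + 1" "real j \<le> 2 ^ m * y"
        "2 ^ m * y < real j + 1" using i(1) j(1) by (simp_all add: floor_eq_iff)
      moreover have "2 ^ m * x \<le> 2 ^ m * y" using le by (intro mult_left_mono) auto
      moreover have "2 ^ m * y \<le> 2 ^ m * x + 1" using hm by (simp add: h_def algebra_simps)
      ultimately have "real i < real (j + 1)" "real j < real (i + 2)"
        unfolding of_nat_add by linarith+
      then show ?thesis by linarith
    qed
    then have near: "\<bar>v (dyadic_floor m y) - v (dyadic_floor m x)\<bar> \<le> C * q ^ m"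
    proof
      assume "j = i" then show ?thesis using i j C q_unit by simp
    next
      assume "j = Suc i" then show ?thesis using i j inc[of i m] by simp
    qed
    have "\<bar>dyadic_limit v x - dyadic_limit v y\<bar> \<le> C * q ^ m / (1 - q) + C * q ^ m + C * q ^ m / (1 - q)"
      using dyadic_limit_tendsto(2)[of x m] dyadic_limit_tendsto(2)[of y m] near le by auto
    also have "\<dots> = C * ((2 / (1 - q) + 1) / q) * q ^ Suc m"
      using q_unit by (simp add: distrib_left distrib_right add_divide_distrib)
    also have "\<dots> \<le> C * ((2 / (1 - q) + 1) / q) * h powr \<gamma>"
      using qh C q_unit by (intro mult_left_mono) auto
    finally show ?thesis using h by (simp add: h_def)
  qed simp
qed

end

section \<open>From moment bounds to a random Hoelder constant\<close>

context prob_space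
begin

text \<open>The p-th powers of all normalised increments of all levels are put into one series
  \<open>S\<close>. Its expectation is finite, and each single increment is at most the p-th root of
  \<open>S\<close>.\<close>

lemma dyadic_increment_bound:
  fixes V :: "real \<Rightarrow> 'a \<Rightarrow> real" and p :: nat
  assumes V[measurable]: "\<And>x. x \<in> {0..1} \<Longrightarrow> V x \<in> borel_measurable M"
    and p: "0 < p" and K: "0 \<le> K"
    and mom: "\<And>x y. x \<in> {0..1} \<Longrightarrow> y \<in> {0..1} \<Longrightarrow>
      (\<integral>\<^sup>+\<omega>. ennreal (\<bar>V x \<omega> - V y \<omega>\<bar> ^ p) \<partial>M) \<le> ennreal (K * \<bar>x - y\<bar> powr (1 + \<beta>))"
    and \<gamma>: "\<gamma> * real p < \<beta>"
  obtains C :: "'a \<Rightarrow> real" where "C \<in> borel_measurable M" "\<And>\<omega>. 0 \<le> C \<omega>"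
    "AE \<omega> in M. \<forall>n. \<forall>i<2 ^ n.
      \<bar>V (real (Suc i) / 2 ^ n) \<omega> - V (real i / 2 ^ n) \<omega>\<bar> \<le> C \<omega> * (2 powr (- \<gamma>)) ^ n"
proof -
  define q where "q = (2::real) powr (- \<gamma>)"
  have q0: "0 < q" by (simp add: q_def)
  have mem: "real (Suc i) / 2 ^ n \<in> {0..1}" "real i / 2 ^ n \<in> {0..1}" if "i < 2 ^ n" for i n :: nat
  proof -
    have "real (Suc i) \<le> 2 ^ n"
      using that by (metis Suc_leI of_nat_le_iff of_nat_numeral of_nat_power)
    moreover from this have "real i \<le> 2 ^ n" by linarith
    ultimately     show "real (Suc i) / 2 ^ n \<in> {0..1}" "real i / 2 ^ n \<in> {0..1}"
      unfolding atLeastAtMost_iff by (simp_all del: of_nat_Suc)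
  qed
  define D where "D n i \<omega> = \<bar>V (real (Suc i) / 2 ^ n) \<omega> - V (real i / 2 ^ n) \<omega>\<bar> / q ^ n" for n i \<omega>
  have D[measurable]: "D n i \<in> borel_measurable M" if "i < 2 ^ n" for n i
    using mem[OF that] V unfolding D_def by measurable
  define S where "S \<omega> = (\<Sum>n. \<Sum>i<2 ^ n. ennreal (D n i \<omega> ^ p))" for \<omega>
  have S[measurable]: "S \<in> borel_measurable M"
    unfolding S_def by measurable
  \<comment> \<open>Of the rate 2^(-n (1 + \<beta>)) a factor 2^(-n) pays for the number of
    increments at level n, and the normalisation by \<open>q ^ n\<close> costs 2^(n \<gamma> p). The
    ratio left over is \<rho>, below 1 because \<gamma> p < \<beta>.\<close>
  define \<rho> where "\<rho> = (2::real) powr (\<gamma> * real p - \<beta>)"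
  have \<rho>: "0 < \<rho>" "\<rho> < 1" using \<gamma> by (auto simp: \<rho>_def powr_less_one)
  have eD: "(\<integral>\<^sup>+\<omega>. ennreal (D n i \<omega> ^ p) \<partial>M) \<le> ennreal (K * \<rho> ^ n / 2 ^ n)" if i: "i < 2 ^ n" for n i
  proof -
    have e1: "ennreal (D n i \<omega> ^ p) = ennreal (1 / q ^ (n * p)) *
      ennreal (\<bar>V (real (Suc i) / 2 ^ n) \<omega> - V (real i / 2 ^ n) \<omega>\<bar> ^ p)" for \<omega>
      using q0 by (simp add: D_def power_divide ennreal_mult[symmetric] power_mult)
    have "(\<integral>\<^sup>+\<omega>. ennreal (D n i \<omega> ^ p) \<partial>M) = ennreal (1 / q ^ (n * p)) *
       (\<integral>\<^sup>+\<omega>. ennreal (\<bar>V (real (Suc i) / 2 ^ n) \<omega> - V (real i / 2 ^ n) \<omega>\<bar> ^ p) \<partial>M)"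
      unfolding e1 using mem[OF i] V by (intro nn_integral_cmult) measurable
    also have "\<dots> \<le> ennreal (1 / q ^ (n * p)) *
      ennreal (K * \<bar>real (Suc i) / 2 ^ n - real i / 2 ^ n\<bar> powr (1 + \<beta>))"
      by (intro mult_left_mono mom mem i) simp
    also have "\<dots> = ennreal (1 / q ^ (n * p) * (K * (1 / 2 ^ n) powr (1 + \<beta>)))"
      using K q0 by (subst ennreal_mult[symmetric]) (auto simp: diff_divide_distrib[symmetric])
    also have "1 / q ^ (n * p) * (K * (1 / 2 ^ n) powr (1 + \<beta>)) = K * \<rho> ^ n / 2 ^ n"
    proof -
      have "q ^ (n * p) = 2 powr (- \<gamma> * (real n * real p))"
        by (simp add: q_def powr_realpow[symmetric] powr_powr)
      then have a: "1 / q ^ (n * p) = 2 powr (\<gamma> * (real n * real p))"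
        by (simp add: powr_minus_divide)
      have b: "(1 / 2 ^ n) powr (1 + \<beta>) = (2::real) powr (- real n * (1 + \<beta>))"
        by (simp add: powr_realpow[symmetric] powr_minus_divide[symmetric] powr_powr)
      have c: "\<rho> ^ n / 2 ^ n = 2 powr ((\<gamma> * real p - \<beta>) * real n - real n)"
        by (simp add: \<rho>_def powr_realpow[symmetric] powr_powr powr_diff[symmetric] del: powr_diff)
      show ?thesis unfolding a b times_divide_eq_right[symmetric] c
        by (simp add: powr_add[symmetric] algebra_simps)
    qed
    finally show ?thesis .
  qed
  have "(\<integral>\<^sup>+\<omega>. S \<omega> \<partial>M) = (\<Sum>n. \<Sum>i<2 ^ n. \<integral>\<^sup>+\<omega>. ennreal (D n i \<omega> ^ p) \<partial>M)"
    unfolding S_def by (subst nn_integral_suminf) (auto intro!: suminf_cong nn_integral_sum)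
  also have "\<dots> \<le> (\<Sum>n. ennreal (K * \<rho> ^ n))"
  proof (intro suminf_le summableI)
    fix n
    have "(\<Sum>i<2 ^ n. \<integral>\<^sup>+\<omega>. ennreal (D n i \<omega> ^ p) \<partial>M) \<le> (\<Sum>i<(2::nat) ^ n. ennreal (K * \<rho> ^ n / 2 ^ n))"
      by (intro sum_mono eD) simp
    also have "\<dots> = ennreal (K * \<rho> ^ n)"
      using K \<rho> by (simp add: ennreal_of_nat_eq_real_of_nat ennreal_mult[symmetric])
    finally show "(\<Sum>i<2 ^ n. \<integral>\<^sup>+\<omega>. ennreal (D n i \<omega> ^ p) \<partial>M) \<le> ennreal (K * \<rho> ^ n)" .
  qed
  also have "\<dots> = ennreal (\<Sum>n. K * \<rho> ^ n)"
    using K \<rho> by (intro suminf_ennreal2 summable_mult summable_geometric) auto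
  finally have "(\<integral>\<^sup>+\<omega>. S \<omega> \<partial>M) < \<infinity>" by (simp add: order_le_less_trans)
  then have fin: "AE \<omega> in M. S \<omega> \<noteq> \<infinity>" by (intro nn_integral_PInf_AE) auto
  show ?thesis
  \<comment> \<open>Where \<open>S\<close> is infinite, \<open>enn2real\<close> gives 0, so the
    constant is finite and nonnegative everywhere.\<close>
  proof (rule that[of "\<lambda>\<omega>. root p (enn2real (S \<omega>))"])
    show "AE \<omega> in M. \<forall>n. \<forall>i<2 ^ n. \<bar>V (real (Suc i) / 2 ^ n) \<omega> - V (real i / 2 ^ n) \<omega>\<bar>
        \<le> root p (enn2real (S \<omega>)) * (2 powr (- \<gamma>)) ^ n"
      using fin
    proof eventually_elim
      case (elim \<omega>)
      show ?case
      proof (intro allI impI)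
        fix n i :: nat assume i: "i < 2 ^ n"
        have D0: "0 \<le> D n i \<omega>" using q0 by (simp add: D_def)
        have "ennreal (D n i \<omega> ^ p) \<le> (\<Sum>i<2 ^ n. ennreal (D n i \<omega> ^ p))"
          using i by (intro member_le_sum) auto
        also have "\<dots> \<le> S \<omega>"
          unfolding S_def using sum_le_suminf[of "\<lambda>n. \<Sum>i<2 ^ n. ennreal (D n i \<omega> ^ p)" "{n}"] by simp
        finally have "D n i \<omega> ^ p \<le> enn2real (S \<omega>)"
          using elim D0 enn2real_mono[of "ennreal (D n i \<omega> ^ p)" "S \<omega>"] by (simp add: less_top)
        then have "root p (D n i \<omega> ^ p) \<le> root p (enn2real (S \<omega>))"
          using p by simp
        then have "D n i \<omega> \<le> root p (enn2real (S \<omega>))"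
          using p D0 by (simp add: real_root_power_cancel)
        then show "\<bar>V (real (Suc i) / 2 ^ n) \<omega> - V (real i / 2 ^ n) \<omega>\<bar>
            \<le> root p (enn2real (S \<omega>)) * (2 powr (- \<gamma>)) ^ n"
          using q0 by (simp add: D_def q_def[symmetric] field_simps)
      qed
    qed
  qed (auto simp: p)
qed

lemma dyadic_limit_measurable:
  assumes "\<And>x. x \<in> {0..1} \<Longrightarrow> V x \<in> borel_measurable M" "x \<in> {0..1}"
  shows "(\<lambda>\<omega>. dyadic_limit (\<lambda>z. V z \<omega>) x) \<in> borel_measurable M"
  unfolding dyadic_limit_def
  using assms dyadic_floor_mem by (intro borel_measurable_lim_metric) auto

text \<open>The same modification works for every admissible \<gamma>. It agrees with
  \<open>V x\<close> almost surely by Fatou's lemma, because the moments of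
  \<open>V (dyadic_floor n x) - V x\<close> tend to 0.\<close>

theorem Kolmogorov_Chentsov_unit_interval:
  fixes V :: "real \<Rightarrow> 'a \<Rightarrow> real" and p :: nat
  assumes V: "\<And>x. x \<in> {0..1} \<Longrightarrow> V x \<in> borel_measurable M"
    and p: "0 < p" and K: "0 \<le> K"
    and mom: "\<And>x y. x \<in> {0..1} \<Longrightarrow> y \<in> {0..1} \<Longrightarrow>
      (\<integral>\<^sup>+\<omega>. ennreal (\<bar>V x \<omega> - V y \<omega>\<bar> ^ p) \<partial>M) \<le> ennreal (K * \<bar>x - y\<bar> powr (1 + \<beta>))"
    and \<gamma>: "0 < \<gamma>" "\<gamma> * real p < \<beta>"
  shows "\<exists>C. C \<in> borel_measurable M \<and> (\<forall>\<omega>. 0 < C \<omega>) \<and>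
      (AE \<omega> in M. \<forall>x\<in>{0..1}. \<forall>y\<in>{0..1}.
        \<bar>dyadic_limit (\<lambda>z. V z \<omega>) x - dyadic_limit (\<lambda>z. V z \<omega>) y\<bar> \<le> C \<omega> * \<bar>x - y\<bar> powr \<gamma>)"
    and "\<And>x. x \<in> {0..1} \<Longrightarrow> AE \<omega> in M. dyadic_limit (\<lambda>z. V z \<omega>) x = V x \<omega>"
proof -
  obtain C where C: "C \<in> borel_measurable M" "\<And>\<omega>. 0 \<le> C \<omega>"
    "AE \<omega> in M. \<forall>n. \<forall>i<2 ^ n.
      \<bar>V (real (Suc i) / 2 ^ n) \<omega> - V (real i / 2 ^ n) \<omega>\<bar> \<le> C \<omega> * (2 powr (- \<gamma>)) ^ n"
    by (rule dyadic_increment_bound[where \<gamma>=\<gamma>, OF V p K mom \<gamma>(2)]) blast+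
  define q where "q = (2::real) powr (- \<gamma>)"
  have q: "0 < q" "q < 1" using \<gamma> by (auto simp: q_def powr_less_one)
  define c where "c = (2 / (1 - q) + 1) / q"
  have c: "0 \<le> c" using q by (simp add: c_def)
  \<comment> \<open>Adding 1 makes the constant strictly positive on every path.\<close>
  have "AE \<omega> in M. \<forall>x\<in>{0..1}. \<forall>y\<in>{0..1}.
        \<bar>dyadic_limit (\<lambda>z. V z \<omega>) x - dyadic_limit (\<lambda>z. V z \<omega>) y\<bar> \<le> (C \<omega> * c + 1) * \<bar>x - y\<bar> powr \<gamma>"
    using C(3)
  proof eventually_elim
    case (elim \<omega>)
    show ?case
    proof (intro ballI)
      fix x y :: real assume xy: "x \<in> {0..1}" "y \<in> {0..1}"
      have "\<bar>dyadic_limit (\<lambda>z. V z \<omega>) x - dyadic_limit (\<lambda>z. V z \<omega>) y\<bar> \<le> C \<omega> * c * \<bar>x - y\<bar> powr \<gamma>"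
        using dyadic_limit_Holder[OF \<gamma>(1) refl C(2), of "\<lambda>z. V z \<omega>" \<omega>, OF _ xy] elim
        unfolding c_def q_def by auto
      also have "\<dots> \<le> (C \<omega> * c + 1) * \<bar>x - y\<bar> powr \<gamma>" by (intro mult_right_mono) auto
      finally show "\<bar>dyadic_limit (\<lambda>z. V z \<omega>) x - dyadic_limit (\<lambda>z. V z \<omega>) y\<bar> \<le> (C \<omega> * c + 1) * \<bar>x - y\<bar> powr \<gamma>" .
    qed
  qed
  then show "\<exists>C. C \<in> borel_measurable M \<and> (\<forall>\<omega>. 0 < C \<omega>) \<and>
      (AE \<omega> in M. \<forall>x\<in>{0..1}. \<forall>y\<in>{0..1}.
        \<bar>dyadic_limit (\<lambda>z. V z \<omega>) x - dyadic_limit (\<lambda>z. V z \<omega>) y\<bar> \<le> C \<omega> * \<bar>x - y\<bar> powr \<gamma>)"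
    using C(1,2) c by (intro exI[of _ "\<lambda>\<omega>. C \<omega> * c + 1"]) (auto intro: add_nonneg_pos)
  fix x :: real assume x: "x \<in> {0..1}"
  define Y where "Y = (\<lambda>\<omega>. dyadic_limit (\<lambda>z. V z \<omega>) x)"
  have Vm[measurable]: "V x \<in> borel_measurable M" "\<And>n. V (dyadic_floor n x) \<in> borel_measurable M"
    "Y \<in> borel_measurable M"
    using V x dyadic_floor_mem dyadic_limit_measurable[of V, OF V x] by (auto simp: Y_def)
  have conv: "AE \<omega> in M. (\<lambda>n. V (dyadic_floor n x) \<omega>) \<longlonglongrightarrow> Y \<omega>"
    using C(3)
  proof eventually_elim
    case (elim \<omega>)
    then show ?case unfolding Y_def
      using dyadic_limit_tendsto(1)[OF \<gamma>(1) refl C(2), of "\<lambda>z. V z \<omega>" \<omega>, OF _ x] by auto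
  qed
  have \<beta>: "0 < \<beta>" using \<gamma> p by (smt (verit) mult_nonneg_nonneg of_nat_0_le_iff)
  have "(\<integral>\<^sup>+\<omega>. ennreal (\<bar>Y \<omega> - V x \<omega>\<bar> ^ p) \<partial>M)
    = (\<integral>\<^sup>+\<omega>. liminf (\<lambda>n. ennreal (\<bar>V (dyadic_floor n x) \<omega> - V x \<omega>\<bar> ^ p)) \<partial>M)"
  proof (rule nn_integral_cong_AE)
    show "AE \<omega> in M. ennreal (\<bar>Y \<omega> - V x \<omega>\<bar> ^ p) = liminf (\<lambda>n. ennreal (\<bar>V (dyadic_floor n x) \<omega> - V x \<omega>\<bar> ^ p))"
      using conv
    proof eventually_elim
      case (elim \<omega>)
      then have "(\<lambda>n. ennreal (\<bar>V (dyadic_floor n x) \<omega> - V x \<omega>\<bar> ^ p)) \<longlonglongrightarrow> ennreal (\<bar>Y \<omega> - V x \<omega>\<bar> ^ p)"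
        by (intro tendsto_intros)
      from lim_imp_Liminf[OF _ this] show ?case by simp
    qed
  qed
  also have "\<dots> \<le> liminf (\<lambda>n. \<integral>\<^sup>+\<omega>. ennreal (\<bar>V (dyadic_floor n x) \<omega> - V x \<omega>\<bar> ^ p) \<partial>M)"
    by (intro nn_integral_liminf) auto
  also have "\<dots> \<le> liminf (\<lambda>n. ennreal (K * \<bar>dyadic_floor n x - x\<bar> powr (1 + \<beta>)))"
    using x dyadic_floor_mem by (intro Liminf_mono always_eventually allI mom) auto
  also have "\<dots> = 0"
  proof -
    have "(\<lambda>n. \<bar>dyadic_floor n x - x\<bar>) \<longlonglongrightarrow> 0"
    proof (rule tendsto_sandwich[OF _ _ tendsto_const])
      show "(\<lambda>n. 1 / 2 ^ n :: real) \<longlonglongrightarrow> 0"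
        using LIMSEQ_realpow_zero[of "1/2::real"] by (simp add: power_divide)
    qed (use dyadic_floor_dist in auto)
    then have "(\<lambda>n. ennreal (K * \<bar>dyadic_floor n x - x\<bar> powr (1 + \<beta>))) \<longlonglongrightarrow> ennreal (K * 0 powr (1 + \<beta>))"
      using \<beta> by (intro tendsto_ennrealI tendsto_mult tendsto_const tendsto_powr') auto
    then show ?thesis using \<beta> by (simp add: lim_imp_Liminf)
  qed
  finally have "(\<integral>\<^sup>+\<omega>. ennreal (\<bar>Y \<omega> - V x \<omega>\<bar> ^ p) \<partial>M) = 0" by simp
  then have "AE \<omega> in M. ennreal (\<bar>Y \<omega> - V x \<omega>\<bar> ^ p) = 0"
    by (subst (asm) nn_integral_0_iff_AE) auto
  then show "AE \<omega> in M. dyadic_limit (\<lambda>z. V z \<omega>) x = V x \<omega>"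
    unfolding Y_def[symmetric]
  proof eventually_elim
    case (elim \<omega>)
    then have "\<bar>Y \<omega> - V x \<omega>\<bar> ^ p \<le> 0" by (simp add: ennreal_eq_0_iff)
    then have "\<bar>Y \<omega> - V x \<omega>\<bar> ^ p = 0" by (meson antisym zero_le_power abs_ge_zero)
    then show ?case by (simp add: Y_def)
  qed
qed

end

section \<open>Heat kernels and iterated potentials\<close>

lemma heat_kernel_normal_density: "0 \<le> \<epsilon> \<Longrightarrow> heat_kernel \<epsilon> y = normal_density 0 (sqrt \<epsilon>) y"
  by (simp add: heat_kernel_def normal_density_def)

lemma heat_kernel_nonneg: "0 \<le> heat_kernel \<epsilon> y" if "0 \<le> \<epsilon>"
  using that by (simp add: heat_kernel_def)

lemma heat_kernel_measurable [measurable]: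
  assumes [measurable]: "f \<in> borel_measurable M" "g \<in> borel_measurable M"
  shows "(\<lambda>x. heat_kernel (f x) (g x)) \<in> borel_measurable M"
  unfolding heat_kernel_def by measurable

lemma continuous_on_heat_kernel [continuous_intros]:
  "0 < \<epsilon> \<Longrightarrow> continuous_on A f \<Longrightarrow> continuous_on A (\<lambda>x. heat_kernel \<epsilon> (f x))"
  unfolding heat_kernel_def by (intro continuous_intros) auto

lemma heat_kernel_has_bochner_integral:
  assumes "0 < \<epsilon>" shows "has_bochner_integral lborel (\<lambda>w. heat_kernel \<epsilon> (w - a)) 1"
proof -
  have "heat_kernel \<epsilon> (w - a) = normal_density a (sqrt \<epsilon>) w" for w
    using assms by (simp add: heat_kernel_def normal_density_def)
  then show ?thesis
    using assms integrable_normal_density[of "sqrt \<epsilon>" a] integral_normal_density[of "sqrt \<epsilon>" a]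
    by (simp add: has_bochner_integral_iff)
qed

lemma heat_kernel_le:
  assumes v: "0 < v" shows "heat_kernel v y \<le> v powr (- 1 / 2)"
proof -
  have "heat_kernel v y \<le> 1 / sqrt (2 * pi * v) * 1"
    unfolding heat_kernel_def using v by (intro mult_left_mono) auto
  also have "\<dots> \<le> 1 / sqrt v * 1"
    using v pi_gt3 by (intro mult_right_mono divide_left_mono) auto
  also have "\<dots> = v powr (- 1 / 2)"
    using v by (simp add: powr_minus_divide powr_half_sqrt)
  finally show ?thesis .
qed

text \<open>Mean value theorem: with u = |y| / sqrt v one has u \<le> 1 + u^2/2 \<le> exp (u^2/2),
  so the Gaussian absorbs the linear factor of its derivative.\<close>

lemma heat_kernel_Lipschitz:
  assumes v: "0 < v" shows "\<bar>heat_kernel v a - heat_kernel v b\<bar> \<le> \<bar>a - b\<bar> / v"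
proof -
  let ?d = "\<lambda>y. - y / v * heat_kernel v y"
  have d: "((\<lambda>y. heat_kernel v y) has_field_derivative ?d y) (at y)" for y
    unfolding heat_kernel_def using v by (auto intro!: derivative_eq_intros simp: field_simps)
  have bd: "\<bar>?d y\<bar> \<le> 1 / v" for y
  proof -
    have "0 \<le> (\<bar>y\<bar> / sqrt v - 1)\<^sup>2 + 1" by simp
    also have "\<dots> = y\<^sup>2 / v - 2 * (\<bar>y\<bar> / sqrt v) + 2"
      using v by (simp add: power2_diff power_divide)
    finally have "\<bar>y\<bar> / sqrt v \<le> 1 + y\<^sup>2 / (2 * v)" by simp
    also have "\<dots> \<le> exp (y\<^sup>2 / (2 * v))" by (rule exp_ge_add_one_self)
    finally have "\<bar>y\<bar> \<le> sqrt v * exp (y\<^sup>2 / (2 * v))" using v by (simp add: field_simps)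
    then have "\<bar>y\<bar> * exp (- y\<^sup>2 / (2 * v)) \<le> sqrt v"
      by (simp add: exp_minus field_simps)
    also have "\<dots> \<le> sqrt (2 * pi * v)" using v pi_gt3 by simp
    finally have "\<bar>y\<bar> * heat_kernel v y \<le> 1" using v by (simp add: heat_kernel_def field_simps)
    then have "\<bar>y\<bar> * heat_kernel v y / v \<le> 1 / v" using v by (intro divide_right_mono) auto
    then show ?thesis using v heat_kernel_nonneg[of v y] by (simp add: abs_mult)
  qed
  have "norm (heat_kernel v a - heat_kernel v b) \<le> 1 / v * norm (a - b)"
    by (rule field_differentiable_bound[of UNIV "heat_kernel v" ?d])
      (use d bd in \<open>auto intro: has_field_derivative_at_within\<close>)
  then show ?thesis by simp
qed

text \<open>Interpolation: the increment d is split as d^(1 - \<theta>) d^\<theta>; the first factor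
  takes the sup bound v^(-1/2), the second the Lipschitz bound.\<close>

lemma heat_kernel_Holder:
  assumes v: "0 < v" and \<theta>: "0 \<le> \<theta>" "\<theta> \<le> 1"
  shows "\<bar>heat_kernel v a - heat_kernel v b\<bar> \<le> \<bar>a - b\<bar> powr \<theta> * v powr (- (1 + \<theta>) / 2)"
proof (cases "heat_kernel v a = heat_kernel v b")
  case False
  define d where "d = \<bar>heat_kernel v a - heat_kernel v b\<bar>"
  have d0: "0 < d" using False by (simp add: d_def)
  have d1: "d \<le> v powr (- 1 / 2)"
    using heat_kernel_le[OF v, of a] heat_kernel_le[OF v, of b] heat_kernel_nonneg[of v a]
      heat_kernel_nonneg[of v b] v unfolding d_def by linarith
  have d2: "d \<le> \<bar>a - b\<bar> / v" unfolding d_def by (rule heat_kernel_Lipschitz[OF v])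
  have "d = d powr (1 - \<theta>) * d powr \<theta>" using d0 by (simp add: powr_add[symmetric])
  also have "\<dots> \<le> (v powr (- 1 / 2)) powr (1 - \<theta>) * (\<bar>a - b\<bar> / v) powr \<theta>"
    using d0 d1 d2 \<theta> by (intro mult_mono powr_mono2) auto
  also have "\<dots> = \<bar>a - b\<bar> powr \<theta> * (v powr (- 1 / 2 * (1 - \<theta>)) * v powr (- \<theta>))"
    using v by (simp add: powr_powr powr_divide powr_minus_divide)
  also have "v powr (- 1 / 2 * (1 - \<theta>)) * v powr (- \<theta>) = v powr (- (1 + \<theta>) / 2)"
    unfolding powr_add[symmetric] by (rule arg_cong[where f = "\<lambda>e. v powr e"]) (simp add: field_simps)
  finally show ?thesis by (simp add: d_def)
qed simp

lemma integrable_powr_singularity: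
  fixes r t \<kappa> :: real
  assumes \<kappa>: "\<kappa> < 1" and rt: "r \<le> t"
  shows "has_bochner_integral lborel (\<lambda>s. indicator {r<..t} s * (s - r) powr (- \<kappa>))
    ((t - r) powr (1 - \<kappa>) / (1 - \<kappa>))"
proof -
  have "((\<lambda>x. x powr (- \<kappa>)) has_integral ((t - r) powr (- \<kappa> + 1) / (- \<kappa> + 1))) {0..t - r}"
    using assms by (intro has_integral_powr_from_0) auto
  then have "((\<lambda>x. if x \<in> {0..t - r} then x powr (- \<kappa>) else 0) has_integral ((t - r) powr (1 - \<kappa>) / (1 - \<kappa>))) UNIV"
    unfolding has_integral_restrict_UNIV by simp
  \<comment> \<open>At 0 \<open>powr\<close> has the value 0, so closed and half-open interval
    define the same integrand.\<close>
  then have "((\<lambda>x. indicator {0<..t - r} x * x powr (- \<kappa>)) has_integral ((t - r) powr (1 - \<kappa>) / (1 - \<kappa>))) UNIV"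
    by (rule has_integral_eq[rotated]) (auto simp: indicator_def)
  then have "integral\<^sup>N lborel (\<lambda>x. indicator {0<..t - r} x * x powr (- \<kappa>)) = ennreal ((t - r) powr (1 - \<kappa>) / (1 - \<kappa>))"
    by (intro nn_integral_has_integral_lborel) auto
  then have "has_bochner_integral lborel (\<lambda>x. indicator {0<..t - r} x * x powr (- \<kappa>)) ((t - r) powr (1 - \<kappa>) / (1 - \<kappa>))"
    using \<kappa> by (intro has_bochner_integral_nn_integral) auto
  then have "has_bochner_integral lborel (\<lambda>x. indicator {0<..t - r} (- r + 1 * x) * (- r + 1 * x) powr (- \<kappa>))
      (((t - r) powr (1 - \<kappa>) / (1 - \<kappa>)) /\<^sub>R \<bar>1\<bar>)"
    by (subst (asm) lborel_has_bochner_integral_real_affine_iff[of 1 _ _ "- r"]) auto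
  moreover have "(\<lambda>x. indicator {0<..t - r} (- r + 1 * x) * (- r + 1 * x) powr (- \<kappa>))
      = (\<lambda>x. indicator {r<..t} x * (x - r) powr (- \<kappa>))"
    by (auto simp: indicator_def)
  ultimately show ?thesis by (simp only: abs_one scaleR_one inverse_1)
qed

text \<open>Every estimate of a transition enters a potential through this time integral. Replacing
  t - r by t makes the constant independent of r.\<close>

lemma powr_dominated_integral:
  fixes g :: "real \<Rightarrow> real"
  assumes g[measurable]: "g \<in> borel_measurable borel"
    and bd: "\<And>s. r < s \<Longrightarrow> s \<le> t \<Longrightarrow> \<bar>g s\<bar> \<le> B * (s - r) powr (- \<kappa>)"
    and \<kappa>: "\<kappa> < 1" and rt: "0 \<le> r" "r \<le> t" and B: "0 \<le> B"
  shows "integrable lborel (\<lambda>s. indicator {r<..t} s * g s)"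
    and "\<bar>LINT s|lborel. indicator {r<..t} s * g s\<bar> \<le> B * (t powr (1 - \<kappa>) / (1 - \<kappa>))"
proof -
  note hb = integrable_powr_singularity[OF \<kappa> rt(2)]
  have le: "norm (indicator {r<..t} s * g s) \<le> B * (indicator {r<..t} s * (s - r) powr (- \<kappa>))" for s
    using bd[of s] by (auto simp: indicator_def)
  have i: "integrable lborel (\<lambda>s. B * (indicator {r<..t} s * (s - r) powr (- \<kappa>)))"
    using hb by (simp add: has_bochner_integral_iff)
  show ig: "integrable lborel (\<lambda>s. indicator {r<..t} s * g s)"
    by (rule Bochner_Integration.integrable_bound[OF i]) (use le in \<open>auto intro: order_trans[OF _ abs_ge_self]\<close>)
  have "\<bar>LINT s|lborel. indicator {r<..t} s * g s\<bar> \<le> (LINT s|lborel. norm (indicator {r<..t} s * g s))"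
    using integral_norm_bound[of lborel "\<lambda>s. indicator {r<..t} s * g s"] by simp
  also have "\<dots> \<le> (LINT s|lborel. B * (indicator {r<..t} s * (s - r) powr (- \<kappa>)))"
    by (intro integral_mono integrable_norm ig i le)
  also have "\<dots> = B * ((t - r) powr (1 - \<kappa>) / (1 - \<kappa>))"
    using hb by (simp add: has_bochner_integral_iff)
  also have "\<dots> \<le> B * (t powr (1 - \<kappa>) / (1 - \<kappa>))"
    using rt \<kappa> B by (intro mult_left_mono divide_right_mono powr_mono2) auto
  finally show "\<bar>LINT s|lborel. indicator {r<..t} s * g s\<bar> \<le> B * (t powr (1 - \<kappa>) / (1 - \<kappa>))" .
qed

text \<open>Transition kernels of a linear Gaussian Markov process on \<open>[0,t]\<close>: from \<open>z\<close> at time \<open>r\<close> it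
  moves to a Gaussian with mean \<open>m r s * z\<close> and variance \<open>v r s\<close> at time \<open>s\<close>.\<close>

locale gaussian_kernel =
  fixes v m :: "real \<Rightarrow> real \<Rightarrow> real" and t c :: real
  assumes t_pos: "0 < t" and c_pos: "0 < c"
    and v_measurable: "case_prod v \<in> borel_measurable (borel \<Otimes>\<^sub>M borel)"
    and m_measurable: "case_prod m \<in> borel_measurable (borel \<Otimes>\<^sub>M borel)"
    and v_lower: "\<And>r s. 0 \<le> r \<Longrightarrow> r < s \<Longrightarrow> s \<le> t \<Longrightarrow> c * (s - r) \<le> v r s"
    and m_unit: "\<And>r s. 0 \<le> r \<Longrightarrow> r < s \<Longrightarrow> s \<le> t \<Longrightarrow> \<bar>m r s\<bar> \<le> 1"
begin

lemma v_meas [measurable (raw)]: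
  assumes [measurable]: "f \<in> borel_measurable N" "g \<in> borel_measurable N"
  shows "(\<lambda>x. v (f x) (g x)) \<in> borel_measurable N"
proof -
  have "(\<lambda>x. case_prod v (f x, g x)) \<in> borel_measurable N"
    by (rule measurable_compose[OF _ v_measurable]) measurable
  then show ?thesis by simp
qed

lemma m_meas [measurable (raw)]:
  assumes [measurable]: "f \<in> borel_measurable N" "g \<in> borel_measurable N"
  shows "(\<lambda>x. m (f x) (g x)) \<in> borel_measurable N"
proof -
  have "(\<lambda>x. case_prod m (f x, g x)) \<in> borel_measurable N"
    by (rule measurable_compose[OF _ m_measurable]) measurable
  then show ?thesis by simp
qed

lemma v_pos: "0 \<le> r \<Longrightarrow> r < s \<Longrightarrow> s \<le> t \<Longrightarrow> 0 < v r s"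
  using v_lower[of r s] c_pos by (smt (verit) mult_pos_pos)

text \<open>The density in \<open>w\<close> of the position at time \<open>s\<close> after a start
  in \<open>z\<close> at time \<open>r\<close>.\<close>

definition q :: "real \<Rightarrow> real \<Rightarrow> real \<Rightarrow> real \<Rightarrow> real" where
  "q r z s w = heat_kernel (v r s) (w - m r s * z)"

lemma q_measurable [measurable (raw)]:
  assumes [measurable]: "f1 \<in> borel_measurable N" "f2 \<in> borel_measurable N"
    "f3 \<in> borel_measurable N" "f4 \<in> borel_measurable N"
  shows "(\<lambda>x. q (f1 x) (f2 x) (f3 x) (f4 x)) \<in> borel_measurable N"
  unfolding q_def by measurable

definition kexp :: "real \<Rightarrow> real" where "kexp \<theta> = (1 + \<theta>) / 2"

text \<open>The first summand serves the Hoelder bound of the kernel, the second its sup bound,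
  whose milder singularity (s - r)^(-1/2) is at most t^(\<theta>/2) (s - r)^(-(1 + \<theta>)/2). One
  constant and one singularity then cover both.\<close>

definition kconst :: "real \<Rightarrow> real" where
  "kconst \<theta> = c powr (- kexp \<theta>) + c powr (- 1 / 2) * t powr (\<theta> / 2)"

lemma kconst_nonneg: "0 \<le> kconst \<theta>"
  using c_pos t_pos by (simp add: kconst_def)

context
  fixes \<theta> :: real
  assumes \<theta>: "0 < \<theta>" "\<theta> < 1"
begin

lemma q_bound:
  assumes r: "0 \<le> r" "r < s" "s \<le> t"
  shows "\<bar>q r z s w\<bar> \<le> kconst \<theta> * (s - r) powr (- kexp \<theta>)"
proof -
  have vp: "0 < v r s" using v_pos r by simp
  have "\<bar>q r z s w\<bar> = q r z s w" using heat_kernel_nonneg vp by (simp add: q_def)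
  also have "\<dots> \<le> v r s powr (- 1 / 2)" unfolding q_def by (rule heat_kernel_le[OF vp])
  also have "\<dots> \<le> (c * (s - r)) powr (- 1 / 2)"
    using v_lower[OF r] c_pos r by (intro powr_mono2') auto
  also have "\<dots> = c powr (- 1 / 2) * ((s - r) powr (\<theta> / 2) * (s - r) powr (- kexp \<theta>))"
    using c_pos r by (subst powr_mult) (auto simp: powr_add[symmetric] kexp_def add_divide_distrib)
  also have "\<dots> \<le> c powr (- 1 / 2) * (t powr (\<theta> / 2) * (s - r) powr (- kexp \<theta>))"
    using r \<theta> by (intro mult_left_mono mult_right_mono powr_mono2) auto
  also have "\<dots> \<le> kconst \<theta> * (s - r) powr (- kexp \<theta>)"
    by (simp add: kconst_def distrib_right)
  finally show ?thesis .
qed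

lemma heat_kernel_v_Holder:
  assumes r: "0 \<le> r" "r < s" "s \<le> t"
  shows "\<bar>heat_kernel (v r s) a - heat_kernel (v r s) b\<bar> \<le> kconst \<theta> * (s - r) powr (- kexp \<theta>) * \<bar>a - b\<bar> powr \<theta>"
proof -
  have vp: "0 < v r s" using v_pos r by simp
  have le: "\<bar>heat_kernel (v r s) a - heat_kernel (v r s) b\<bar> \<le> \<bar>a - b\<bar> powr \<theta> * v r s powr (- (1 + \<theta>) / 2)"
    using \<theta> by (intro heat_kernel_Holder vp) auto
  have "v r s powr (- (1 + \<theta>) / 2) \<le> (c * (s - r)) powr (- (1 + \<theta>) / 2)"
    using v_lower[OF r] c_pos r \<theta> by (intro powr_mono2') auto
  also have "\<dots> = c powr (- kexp \<theta>) * (s - r) powr (- kexp \<theta>)"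
    using c_pos r by (simp add: powr_mult kexp_def minus_divide_left)
  also have "\<dots> \<le> kconst \<theta> * (s - r) powr (- kexp \<theta>)"
    using t_pos by (intro mult_right_mono) (auto simp: kconst_def)
  finally have "\<bar>a - b\<bar> powr \<theta> * v r s powr (- (1 + \<theta>) / 2)
      \<le> \<bar>a - b\<bar> powr \<theta> * (kconst \<theta> * (s - r) powr (- kexp \<theta>))"
    by (intro mult_left_mono) auto
  with le show ?thesis by (simp add: mult.commute)
qed

lemma q_Holder_target:
  assumes r: "0 \<le> r" "r < s" "s \<le> t"
  shows "\<bar>q r z s w - q r z s w'\<bar> \<le> kconst \<theta> * (s - r) powr (- kexp \<theta>) * \<bar>w - w'\<bar> powr \<theta>"
  using heat_kernel_v_Holder[OF r, of "w - m r s * z" "w' - m r s * z"] by (simp add: q_def)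

text \<open>Displacing the source shifts the mean by \<open>m r s * (z' - z)\<close>, which is no
  larger than the displacement since |m| \<le> 1.\<close>

lemma q_Holder_source:
  assumes r: "0 \<le> r" "r < s" "s \<le> t"
  shows "\<bar>q r z s w - q r z' s w\<bar> \<le> kconst \<theta> * (s - r) powr (- kexp \<theta>) * \<bar>z - z'\<bar> powr \<theta>"
proof -
  have "\<bar>m r s * (z' - z)\<bar> \<le> \<bar>z - z'\<bar>"
    using m_unit[OF r] by (simp add: abs_mult abs_minus_commute mult_left_le_one_le)
  then have "\<bar>m r s * (z' - z)\<bar> powr \<theta> \<le> \<bar>z - z'\<bar> powr \<theta>"
    using \<theta> by (intro powr_mono2) auto
  then have "kconst \<theta> * (s - r) powr (- kexp \<theta>) * \<bar>m r s * (z' - z)\<bar> powr \<theta>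
      \<le> kconst \<theta> * (s - r) powr (- kexp \<theta>) * \<bar>z - z'\<bar> powr \<theta>"
    using kconst_nonneg by (intro mult_left_mono) auto
  with heat_kernel_v_Holder[OF r, of "w - m r s * z" "w - m r s * z'"] show ?thesis
    by (simp add: q_def algebra_simps)
qed

end

section \<open>Transition and potential operators\<close>

definition transition :: "real \<Rightarrow> real \<Rightarrow> (real \<Rightarrow> real) \<Rightarrow> real \<Rightarrow> real" where
  "transition r s \<phi> z = (LINT w|lborel. q r z s w * \<phi> w)"

text \<open>The expected integral of \<open>h s (X s)\<close> over the remaining time, given
  position \<open>z\<close> at time \<open>r\<close>. The instant \<open>s = r\<close> is left out
  because the kernel bounds require \<open>r < s\<close>.\<close>

definition potential :: "(real \<Rightarrow> real \<Rightarrow> real) \<Rightarrow> real \<Rightarrow> real \<Rightarrow> real" where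
  "potential h r z = (LINT s|lborel. indicator {r<..t} s * transition r s (h s) z)"

lemma transition_measurable [measurable (raw)]:
  assumes [measurable]: "f1 \<in> borel_measurable N" "f2 \<in> borel_measurable N" "f3 \<in> borel_measurable N"
    and "(\<lambda>(x, w). h x w) \<in> borel_measurable (N \<Otimes>\<^sub>M borel)"
  shows "(\<lambda>x. transition (f1 x) (f2 x) (h x) (f3 x)) \<in> borel_measurable N"
  using assms(4) unfolding transition_def by (simp add: split_beta') measurable

lemma potential_measurable [measurable]:
  assumes [measurable]: "case_prod h \<in> borel_measurable (borel \<Otimes>\<^sub>M borel)"
  shows "case_prod (potential h) \<in> borel_measurable (borel \<Otimes>\<^sub>M borel)"
  unfolding potential_def indicator_def greaterThanAtMost_iff split_beta'
  by measurable


text \<open>The conditional moment of order n, given X_r = z, of the integral of f(X_s) over [r, t].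
  The factor \<open>Suc n\<close> comes from differentiating a power in the lower limit of
  integration; the factors build up to n!.\<close>

primrec iterated_potential :: "(real \<Rightarrow> real) \<Rightarrow> nat \<Rightarrow> real \<Rightarrow> real \<Rightarrow> real" where
  "iterated_potential f 0 = (\<lambda>r z. 1)"
| "iterated_potential f (Suc n) =
    (\<lambda>r z. real (Suc n) * potential (\<lambda>s w. f w * iterated_potential f n s w) r z)"

lemma iterated_potential_measurable [measurable]:
  assumes [measurable]: "f \<in> borel_measurable borel"
  shows "case_prod (iterated_potential f n) \<in> borel_measurable (borel \<Otimes>\<^sub>M borel)"
proof (induction n)
  case (Suc n)
  note [measurable] = Suc
  have [measurable]: "(\<lambda>(s, w). f w * iterated_potential f n s w) \<in> borel_measurable (borel \<Otimes>\<^sub>M borel)"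
    by measurable
  have [measurable]: "case_prod (potential (\<lambda>s w. f w * iterated_potential f n s w)) \<in> borel_measurable (borel \<Otimes>\<^sub>M borel)"
    by measurable
  show ?case by simp
qed simp

end

text \<open>\<open>f\<close> enters the bound only through its L1 norm, which keeps the later
  constants free of \<epsilon>.\<close>

lemma integral_product_bound:
  fixes k f h :: "'b \<Rightarrow> real"
  assumes [measurable]: "k \<in> borel_measurable N" "h \<in> borel_measurable N"
    and f: "integrable N f" and B: "\<And>w. \<bar>k w\<bar> \<le> B" and K: "\<And>w. \<bar>h w\<bar> \<le> K"
    and I: "(LINT w|N. \<bar>f w\<bar>) \<le> I"
  shows "integrable N (\<lambda>w. k w * (f w * h w))"
    and "\<bar>LINT w|N. k w * (f w * h w)\<bar> \<le> B * I * K"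
proof -
  note [measurable] = borel_measurable_integrable[OF f]
  have BK: "0 \<le> B" "0 \<le> K" using B K abs_ge_zero order_trans by blast+
  have i: "integrable N (\<lambda>w. B * \<bar>f w\<bar> * K)" using f by simp
  have le: "norm (k w * (f w * h w)) \<le> B * \<bar>f w\<bar> * K" for w
    using BK B[of w] K[of w] by (auto simp: abs_mult mult.assoc intro!: mult_mono)
  show ik: "integrable N (\<lambda>w. k w * (f w * h w))"
    by (rule Bochner_Integration.integrable_bound[OF i]) (use le in \<open>auto intro: order_trans[OF _ abs_ge_self]\<close>)
  have "\<bar>LINT w|N. k w * (f w * h w)\<bar> \<le> (LINT w|N. norm (k w * (f w * h w)))"
    using integral_norm_bound[of N "\<lambda>w. k w * (f w * h w)"] by simp
  also have "\<dots> \<le> (LINT w|N. B * \<bar>f w\<bar> * K)"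
    by (intro integral_mono integrable_norm ik i le)
  also have "\<dots> = B * (LINT w|N. \<bar>f w\<bar>) * K" by simp
  also have "\<dots> \<le> B * I * K" using I BK by (intro mult_right_mono mult_left_mono) auto
  finally show "\<bar>LINT w|N. k w * (f w * h w)\<bar> \<le> B * I * K" .
qed

section \<open>Differences of heat kernels as test functions\<close>

definition heat_diff :: "real \<Rightarrow> real \<Rightarrow> real \<Rightarrow> real \<Rightarrow> real" where
  "heat_diff \<epsilon> x y w = heat_kernel \<epsilon> (w - x) - heat_kernel \<epsilon> (w - y)"

lemma heat_diff_measurable [measurable]: "heat_diff \<epsilon> x y \<in> borel_measurable borel"
  unfolding heat_diff_def[abs_def] by measurable

lemma heat_diff_integrable:
  assumes "0 < \<epsilon>"
  shows "integrable lborel (heat_diff \<epsilon> x y)" and "(LINT w|lborel. \<bar>heat_diff \<epsilon> x y w\<bar>) \<le> 2"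
proof -
  note hb = heat_kernel_has_bochner_integral[OF assms, unfolded has_bochner_integral_iff]
  show i: "integrable lborel (heat_diff \<epsilon> x y)"
    unfolding heat_diff_def[abs_def] using hb by (intro Bochner_Integration.integrable_diff) auto
  have "(LINT w|lborel. \<bar>heat_diff \<epsilon> x y w\<bar>) \<le> (LINT w|lborel. heat_kernel \<epsilon> (w - x) + heat_kernel \<epsilon> (w - y))"
  proof (intro integral_mono)
    show "\<bar>heat_diff \<epsilon> x y w\<bar> \<le> heat_kernel \<epsilon> (w - x) + heat_kernel \<epsilon> (w - y)" for w
      using heat_kernel_nonneg[of \<epsilon> "w - x"] heat_kernel_nonneg[of \<epsilon> "w - y"] assms
      unfolding heat_diff_def by linarith
  qed (use i hb in auto)
  also have "\<dots> = 2" using hb by simp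
  finally show "(LINT w|lborel. \<bar>heat_diff \<epsilon> x y w\<bar>) \<le> 2" .
qed

text \<open>Shifting both bumps to the origin turns the integral against \<^const>\<open>heat_diff\<close> into an average
  of increments of \<open>g\<close>; the bound does not depend on \<open>\<epsilon>\<close>.\<close>

lemma heat_diff_integral_bound:
  fixes g :: "real \<Rightarrow> real"
  assumes \<epsilon>: "0 < \<epsilon>" and [measurable]: "g \<in> borel_measurable borel" and K: "\<And>w. \<bar>g w\<bar> \<le> K"
    and B: "\<And>w. \<bar>g (x + w) - g (y + w)\<bar> \<le> B"
  shows "\<bar>LINT w|lborel. heat_diff \<epsilon> x y w * g w\<bar> \<le> B"
proof -
  have hb: "integrable lborel (\<lambda>w. heat_kernel \<epsilon> (w - a))" "(LINT w|lborel. heat_kernel \<epsilon> (w - a)) = 1" for a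
    using heat_kernel_has_bochner_integral[OF \<epsilon>, of a] by (simp_all add: has_bochner_integral_iff)
  have hp: "integrable lborel (heat_kernel \<epsilon>)" "(LINT w|lborel. heat_kernel \<epsilon> w) = 1"
    using hb[of 0] by simp_all
  have i: "integrable lborel (\<lambda>w. heat_kernel \<epsilon> (w - a) * g w)" for a
    by (rule Bochner_Integration.integrable_bound[where f = "\<lambda>w. K * heat_kernel \<epsilon> (w - a)"])
      (use hb K \<epsilon> heat_kernel_nonneg[of \<epsilon>] in \<open>auto simp: abs_mult mult.commute intro!: mult_mono order_trans[OF K abs_ge_self]\<close>)
  have sh: "(LINT w|lborel. heat_kernel \<epsilon> (w - a) * g w) = (LINT w|lborel. heat_kernel \<epsilon> w * g (a + w))" for a
    using lborel_integral_real_affine[of 1 "\<lambda>w. heat_kernel \<epsilon> (w - a) * g w" a] by simp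
  have i': "integrable lborel (\<lambda>w. heat_kernel \<epsilon> w * g (a + w))" for a
    using lborel_integrable_real_affine[OF i[of a], of 1 a] by simp
  have "(LINT w|lborel. heat_diff \<epsilon> x y w * g w)
     = (LINT w|lborel. heat_kernel \<epsilon> (w - x) * g w) - (LINT w|lborel. heat_kernel \<epsilon> (w - y) * g w)"
    unfolding heat_diff_def using i by (simp add: left_diff_distrib)
  also have "\<dots> = (LINT w|lborel. heat_kernel \<epsilon> w * (g (x + w) - g (y + w)))"
    unfolding sh using i' by (simp add: right_diff_distrib)
  also have "\<bar>\<dots>\<bar> \<le> (LINT w|lborel. norm (heat_kernel \<epsilon> w * (g (x + w) - g (y + w))))"
    using integral_norm_bound[of lborel "\<lambda>w. heat_kernel \<epsilon> w * (g (x + w) - g (y + w))"] by simp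
  also have "\<dots> \<le> (LINT w|lborel. heat_kernel \<epsilon> w * B)"
  proof (intro integral_mono integrable_norm)
    show "integrable lborel (\<lambda>w. heat_kernel \<epsilon> w * (g (x + w) - g (y + w)))"
      using i' by (simp add: right_diff_distrib)
    show "norm (heat_kernel \<epsilon> w * (g (x + w) - g (y + w))) \<le> heat_kernel \<epsilon> w * B" for w
      using heat_kernel_nonneg[of \<epsilon> w] \<epsilon> B[of w] by (auto simp: abs_mult intro!: mult_left_mono)
  qed (use hp in simp)
  also have "\<dots> = B" using hp by simp
  finally show ?thesis .
qed

section \<open>Regularity and gain under potentials\<close>

context gaussian_kernel
begin

context
  fixes \<theta> :: real
  assumes \<theta>: "0 < \<theta>" "\<theta> < 1"
begin

text \<open>The fraction is the integral of s^(-kexp) over [0, t]. In the bounds without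
  cancellation the 2 is the bound on the L1 norm of \<open>f\<close>; in those with cancellation it
  counts the two terms of a product rule.\<close>

definition pconst :: real where
  "pconst = 2 * kconst \<theta> * (t powr (1 - kexp \<theta>) / (1 - kexp \<theta>))"

lemma kexp_less: "kexp \<theta> < 1" using \<theta> by (simp add: kexp_def)

lemma pconst_nonneg: "0 \<le> pconst"
  using kexp_less kconst_nonneg by (simp add: pconst_def)

lemma transition_bound:
  assumes r: "0 \<le> r" "r < s" "s \<le> t"
    and f: "integrable lborel f" "(LINT w|lborel. \<bar>f w\<bar>) \<le> 2"
    and h[measurable]: "h \<in> borel_measurable borel" and K: "\<And>w. \<bar>h w\<bar> \<le> K"
  shows "\<bar>transition r s (\<lambda>w. f w * h w) z\<bar> \<le> 2 * kconst \<theta> * K * (s - r) powr (- kexp \<theta>)"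
    and "\<bar>transition r s (\<lambda>w. f w * h w) z - transition r s (\<lambda>w. f w * h w) z'\<bar>
      \<le> 2 * kconst \<theta> * K * \<bar>z - z'\<bar> powr \<theta> * (s - r) powr (- kexp \<theta>)"
proof -
  have "\<bar>LINT w|lborel. q r z s w * (f w * h w)\<bar> \<le> kconst \<theta> * (s - r) powr (- kexp \<theta>) * 2 * K"
    by (rule integral_product_bound(2)[OF _ _ f(1) q_bound[OF \<theta> r] K f(2)]) measurable
  then show "\<bar>transition r s (\<lambda>w. f w * h w) z\<bar> \<le> 2 * kconst \<theta> * K * (s - r) powr (- kexp \<theta>)"
    unfolding transition_def by (simp add: mult_ac)
  have i: "integrable lborel (\<lambda>w. q r z s w * (f w * h w))" for z
    by (rule integral_product_bound(1)[OF _ _ f(1) q_bound[OF \<theta> r] K f(2)]) measurable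
  have "transition r s (\<lambda>w. f w * h w) z - transition r s (\<lambda>w. f w * h w) z'
     = (LINT w|lborel. (q r z s w - q r z' s w) * (f w * h w))"
    unfolding transition_def using i by (simp add: left_diff_distrib)
  also have "\<bar>\<dots>\<bar> \<le> kconst \<theta> * (s - r) powr (- kexp \<theta>) * \<bar>z - z'\<bar> powr \<theta> * 2 * K"
    by (rule integral_product_bound(2)[OF _ _ f(1) q_Holder_source[OF \<theta> r] K f(2)]) measurable
  finally show "\<bar>transition r s (\<lambda>w. f w * h w) z - transition r s (\<lambda>w. f w * h w) z'\<bar>
      \<le> 2 * kconst \<theta> * K * \<bar>z - z'\<bar> powr \<theta> * (s - r) powr (- kexp \<theta>)"
    by (simp add: mult_ac)
qed

text \<open>The two bumps are compared through the increment of \<open>q * h\<close> over the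
  distance |x - y|, split by the product rule. Sup norm and Hoelder constant of \<open>h\<close>
  share one \<open>K\<close>, so both terms have the same bound.\<close>

lemma transition_heat_diff_bound:
  assumes \<epsilon>: "0 < \<epsilon>" and r: "0 \<le> r" "r < s" "s \<le> t"
    and h[measurable]: "h \<in> borel_measurable borel" and K: "\<And>w. \<bar>h w\<bar> \<le> K"
    and H: "\<And>w w'. \<bar>h w - h w'\<bar> \<le> K * \<bar>w - w'\<bar> powr \<theta>"
  shows "\<bar>transition r s (\<lambda>w. heat_diff \<epsilon> x y w * h w) z\<bar>
    \<le> 2 * kconst \<theta> * K * \<bar>x - y\<bar> powr \<theta> * (s - r) powr (- kexp \<theta>)"
proof -
  let ?A = "kconst \<theta> * (s - r) powr (- kexp \<theta>)"
  have A0: "0 \<le> ?A" using kconst_nonneg by simp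
  have K0: "0 \<le> K" using K[of 0] by linarith
  let ?g = "\<lambda>w. q r z s w * h w"
  have "\<bar>LINT w|lborel. heat_diff \<epsilon> x y w * ?g w\<bar> \<le> ?A * \<bar>x - y\<bar> powr \<theta> * K + ?A * (K * \<bar>x - y\<bar> powr \<theta>)"
  proof (rule heat_diff_integral_bound[OF \<epsilon>])
    show "\<bar>?g w\<bar> \<le> ?A * K" for w
      unfolding abs_mult by (rule mult_mono[OF q_bound[OF \<theta> r] K A0 abs_ge_zero])
    fix w
    define a b a' b' where "a = q r z s (x + w)" and "b = h (x + w)" and "a' = q r z s (y + w)" and "b' = h (y + w)"
    have ab: "\<bar>a - a'\<bar> \<le> ?A * \<bar>x - y\<bar> powr \<theta>" "\<bar>b\<bar> \<le> K" "\<bar>a'\<bar> \<le> ?A" "\<bar>b - b'\<bar> \<le> K * \<bar>x - y\<bar> powr \<theta>"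
      using q_Holder_target[OF \<theta> r, of z "x + w" "y + w"] H[of "x + w" "y + w"] K[of "x + w"]
        q_bound[OF \<theta> r, of z "y + w"] unfolding a_def b_def a'_def b'_def by simp_all
    have "a * b - a' * b' = (a - a') * b + a' * (b - b')" by (simp add: algebra_simps)
    also have "\<bar>\<dots>\<bar> \<le> \<bar>a - a'\<bar> * \<bar>b\<bar> + \<bar>a'\<bar> * \<bar>b - b'\<bar>"
      unfolding abs_mult[symmetric] by (rule abs_triangle_ineq)
    also have "\<dots> \<le> ?A * \<bar>x - y\<bar> powr \<theta> * K + ?A * (K * \<bar>x - y\<bar> powr \<theta>)"
      by (rule add_mono[OF mult_mono[OF ab(1,2)] mult_mono[OF ab(3,4)]]) (use A0 in simp_all)
    finally show "\<bar>?g (x + w) - ?g (y + w)\<bar> \<le> ?A * \<bar>x - y\<bar> powr \<theta> * K + ?A * (K * \<bar>x - y\<bar> powr \<theta>)"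
      unfolding a_def b_def a'_def b'_def .
  qed measurable
  moreover have "transition r s (\<lambda>w. heat_diff \<epsilon> x y w * h w) z = (LINT w|lborel. heat_diff \<epsilon> x y w * ?g w)"
    unfolding transition_def by (simp only: mult.left_commute)
  ultimately show ?thesis by (simp only:) (simp add: algebra_simps)
qed

text \<open>Hoelder continuity is produced by the source variable of the kernel, so a merely bounded
  \<open>h\<close> suffices.\<close>

lemma potential_bounds:
  assumes r: "0 \<le> r" "r \<le> t"
    and f: "integrable lborel f" "(LINT w|lborel. \<bar>f w\<bar>) \<le> 2"
    and h[measurable]: "case_prod h \<in> borel_measurable (borel \<Otimes>\<^sub>M borel)"
    and K: "\<And>s w. 0 \<le> s \<Longrightarrow> s \<le> t \<Longrightarrow> \<bar>h s w\<bar> \<le> K"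
  shows "integrable lborel (\<lambda>s. indicator {r<..t} s * transition r s (\<lambda>w. f w * h s w) z)"
    and "\<bar>potential (\<lambda>s w. f w * h s w) r z\<bar> \<le> pconst * K"
    and "\<bar>potential (\<lambda>s w. f w * h s w) r z - potential (\<lambda>s w. f w * h s w) r z'\<bar> \<le> pconst * K * \<bar>z - z'\<bar> powr \<theta>"
proof -
  note [measurable] = borel_measurable_integrable[OF f(1)]
  have K0: "0 \<le> K" using order_trans[OF abs_ge_zero K[OF r]] .
  have [measurable]: "h s \<in> borel_measurable borel" for s
    by (rule measurable_compose[OF _ h, of "\<lambda>w. (s, w)", simplified]) measurable
  have tm[measurable]: "(\<lambda>s. transition r s (\<lambda>w. f w * h s w) z) \<in> borel_measurable borel" for z
    by measurable
  have tb: "\<bar>transition r s (\<lambda>w. f w * h s w) z\<bar> \<le> 2 * kconst \<theta> * K * (s - r) powr (- kexp \<theta>)"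
    if "r < s" "s \<le> t" for s z
    using that r by (intro transition_bound f K) auto
  have th: "\<bar>transition r s (\<lambda>w. f w * h s w) z - transition r s (\<lambda>w. f w * h s w) z'\<bar>
      \<le> 2 * kconst \<theta> * K * \<bar>z - z'\<bar> powr \<theta> * (s - r) powr (- kexp \<theta>)"
    if "r < s" "s \<le> t" for s
    using that r by (intro transition_bound f K) auto
  have B0: "0 \<le> 2 * kconst \<theta> * K" using K0 kconst_nonneg by simp
  note pd = powr_dominated_integral[OF tm tb kexp_less r B0]
  show i: "integrable lborel (\<lambda>s. indicator {r<..t} s * transition r s (\<lambda>w. f w * h s w) z)" for z
    by (rule pd(1))
  show "\<bar>potential (\<lambda>s w. f w * h s w) r z\<bar> \<le> pconst * K"
    using pd(2)[of z] by (simp add: potential_def pconst_def mult_ac)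
  have "potential (\<lambda>s w. f w * h s w) r z - potential (\<lambda>s w. f w * h s w) r z'
    = (LINT s|lborel. indicator {r<..t} s * (transition r s (\<lambda>w. f w * h s w) z - transition r s (\<lambda>w. f w * h s w) z'))"
    unfolding potential_def using i by (simp add: right_diff_distrib)
  also have "\<bar>\<dots>\<bar> \<le> 2 * kconst \<theta> * K * \<bar>z - z'\<bar> powr \<theta> * (t powr (1 - kexp \<theta>) / (1 - kexp \<theta>))"
    using B0 by (intro powr_dominated_integral(2) th kexp_less r) auto
  finally show "\<bar>potential (\<lambda>s w. f w * h s w) r z - potential (\<lambda>s w. f w * h s w) r z'\<bar> \<le> pconst * K * \<bar>z - z'\<bar> powr \<theta>"
    by (simp add: pconst_def mult_ac)
qed

lemma potential_heat_diff_bound: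
  assumes \<epsilon>: "0 < \<epsilon>" and r: "0 \<le> r" "r \<le> t"
    and h[measurable]: "case_prod h \<in> borel_measurable (borel \<Otimes>\<^sub>M borel)"
    and K: "\<And>s w. 0 \<le> s \<Longrightarrow> s \<le> t \<Longrightarrow> \<bar>h s w\<bar> \<le> K"
    and H: "\<And>s w w'. 0 \<le> s \<Longrightarrow> s \<le> t \<Longrightarrow> \<bar>h s w - h s w'\<bar> \<le> K * \<bar>w - w'\<bar> powr \<theta>"
  shows "\<bar>potential (\<lambda>s w. heat_diff \<epsilon> x y w * h s w) r z\<bar> \<le> pconst * K * \<bar>x - y\<bar> powr \<theta>"
proof -
  have K0: "0 \<le> K" using order_trans[OF abs_ge_zero K[OF r]] .
  have [measurable]: "h s \<in> borel_measurable borel" for s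
    by (rule measurable_compose[OF _ h, of "\<lambda>w. (s, w)", simplified]) measurable
  have "\<bar>potential (\<lambda>s w. heat_diff \<epsilon> x y w * h s w) r z\<bar>
    \<le> 2 * kconst \<theta> * K * \<bar>x - y\<bar> powr \<theta> * (t powr (1 - kexp \<theta>) / (1 - kexp \<theta>))"
    unfolding potential_def
  proof (rule powr_dominated_integral(2))
    fix s assume "r < s" "s \<le> t"
    then show "\<bar>transition r s (\<lambda>w. heat_diff \<epsilon> x y w * h s w) z\<bar>
      \<le> 2 * kconst \<theta> * K * \<bar>x - y\<bar> powr \<theta> * (s - r) powr (- kexp \<theta>)"
      using r by (intro transition_heat_diff_bound \<epsilon> K H) auto
  qed (use K0 kconst_nonneg r kexp_less in auto)
  then show ?thesis by (simp add: pconst_def mult_ac)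
qed

text \<open>Induction by two orders at a time. The first step turns a bounded potential into one
  that is bounded and Hoelder with the same constant \<open>?K'\<close>, without gain; the second
  spends this regularity on a factor |x - y|^\<theta>.\<close>

lemma iterated_potential_even_bound:
  assumes \<epsilon>: "0 < \<epsilon>" and r: "0 \<le> r" "r \<le> t"
  shows "\<bar>iterated_potential (heat_diff \<epsilon> x y) (2 * k) r z\<bar>
    \<le> fact (2 * k) * pconst ^ (2 * k) * (\<bar>x - y\<bar> powr \<theta>) ^ k"
  using r
proof (induction k arbitrary: r z)
  case (Suc k)
  let ?u = "iterated_potential (heat_diff \<epsilon> x y)"
  let ?K = "fact (2 * k) * pconst ^ (2 * k) * (\<bar>x - y\<bar> powr \<theta>) ^ k"
  let ?K' = "real (Suc (2 * k)) * (pconst * ?K)"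
  note f = heat_diff_integrable[OF \<epsilon>, of x y]
  note pb = potential_bounds[OF _ _ f iterated_potential_measurable Suc.IH]
  have 1: "\<bar>?u (Suc (2 * k)) s w\<bar> \<le> ?K'" if "0 \<le> s" "s \<le> t" for s w
    using pb(2)[OF that, of w] unfolding iterated_potential.simps abs_mult abs_of_nat
    by (intro mult_left_mono) auto
  have 2: "\<bar>?u (Suc (2 * k)) s w - ?u (Suc (2 * k)) s w'\<bar> \<le> ?K' * \<bar>w - w'\<bar> powr \<theta>"
    if "0 \<le> s" "s \<le> t" for s w w'
    using pb(3)[OF that, of w w'] unfolding iterated_potential.simps right_diff_distrib[symmetric] abs_mult abs_of_nat mult.assoc
    by (intro mult_left_mono) auto
  have "\<bar>?u (Suc (Suc (2 * k))) r z\<bar> \<le> real (Suc (Suc (2 * k))) * (pconst * ?K' * \<bar>x - y\<bar> powr \<theta>)"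
    unfolding iterated_potential.simps(2)[of _ "Suc (2 * k)"] abs_mult abs_of_nat
    by (intro mult_left_mono potential_heat_diff_bound \<epsilon> Suc.prems 1 2) auto
  also have "\<dots> = fact (2 * Suc k) * pconst ^ (2 * Suc k) * (\<bar>x - y\<bar> powr \<theta>) ^ Suc k"
    unfolding mult_Suc_right add_2_eq_Suc fact_Suc power_Suc of_nat_mult by (simp only: mult_ac)
  finally show ?case by simp
qed simp

end

end

section \<open>Moments of additive functionals\<close>

text \<open>Evaluating at dyadic floors of time involves countably many values, hence joint
  measurability, and continuity passes it to the limit. \<open>max 0\<close> freezes the process at
  negative times, where nothing is known of it.\<close>

lemma borel_measurable_continuous_process:
  fixes X :: "real \<Rightarrow> 'b \<Rightarrow> real"
  assumes X: "\<And>s. 0 \<le> s \<Longrightarrow> X s \<in> borel_measurable N"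
    and cont: "\<And>\<omega>. \<omega> \<in> space N \<Longrightarrow> continuous_on {0..} (\<lambda>s. X s \<omega>)"
  shows "(\<lambda>(s, \<omega>). X (max 0 s) \<omega>) \<in> borel_measurable (borel \<Otimes>\<^sub>M N)"
  unfolding split_beta'
proof (rule borel_measurable_LIMSEQ_metric)
  fix n :: nat
  have [measurable]: "X (max 0 a) \<in> borel_measurable N" for a by (rule X) simp
  show "(\<lambda>p. X (max 0 (dyadic_floor n (fst p))) (snd p)) \<in> borel_measurable (borel \<Otimes>\<^sub>M N)"
    unfolding dyadic_floor_def by (rule measurable_compose_countable) measurable
next
  fix p :: "real \<times> 'b" assume p: "p \<in> space (borel \<Otimes>\<^sub>M N)"
  have "(\<lambda>n. 1 / 2 ^ n :: real) \<longlonglongrightarrow> 0"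
    using LIMSEQ_realpow_zero[of "1/2::real"] by (simp add: power_divide)
  from tendsto_sandwich[OF _ _ tendsto_const this, of "\<lambda>n. \<bar>dyadic_floor n (fst p) - fst p\<bar>"]
  have "(\<lambda>n. \<bar>dyadic_floor n (fst p) - fst p\<bar>) \<longlonglongrightarrow> 0"
    using dyadic_floor_dist by auto
  then have "(\<lambda>n. dyadic_floor n (fst p)) \<longlonglongrightarrow> fst p"
    by (simp add: tendsto_rabs_zero_iff LIM_zero_iff)
  then have "(\<lambda>n. max 0 (dyadic_floor n (fst p))) \<longlonglongrightarrow> max 0 (fst p)"
    by (intro tendsto_max tendsto_const)
  then show "(\<lambda>n. X (max 0 (dyadic_floor n (fst p))) (snd p)) \<longlonglongrightarrow> X (max 0 (fst p)) (snd p)"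
    using p by (intro continuous_on_tendsto_compose[OF cont]) (auto simp: space_pair_measure)
qed

text \<open>The fundamental theorem of calculus for -(B s)^(n + 1), whose derivative in s is (n + 1)
  g(s) (B s)^n. The earliest time is isolated and an n-th power of the remaining integral is
  left.\<close>

lemma power_of_integral:
  fixes g :: "real \<Rightarrow> real"
  assumes g: "continuous_on UNIV g" and rt: "r \<le> t"
  defines "B \<equiv> \<lambda>s. LINT u|lborel. indicator {s..t} u * g u"
  shows "B r ^ Suc n = (LINT s|lborel. indicator {r..t} s * (real (Suc n) * (g s * B s ^ n)))"
proof -
  have ic: "isCont g x" for x using g by (simp add: continuous_on_eq_continuous_at)
  obtain G where "\<forall>x. (G has_vector_derivative g x) (at x)"
    using einterval_antiderivative[of "-\<infinity>" "\<infinity>" g] ic by auto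
  then have G: "DERIV G x :> g x" for x by (simp add: has_real_derivative_iff_has_vector_derivative)
  then have Gc: "isCont G x" for x using DERIV_isCont by blast
  have B: "B s = G t - G s" if "s \<le> t" for s
    using integral_FTC_Icc_real[OF that, of G g] G ic by (simp add: B_def mult.commute)
  have "(LINT s|lborel. indicator {r..t} s * (real (Suc n) * (g s * B s ^ n)))
      = (LINT s|lborel. (real (Suc n) * (g s * (G t - G s) ^ n)) * indicator {r..t} s)"
    using B by (intro Bochner_Integration.integral_cong) (auto simp: indicator_def)
  also have "\<dots> = - ((G t - G t) ^ Suc n) - (- ((G t - G r) ^ Suc n))"
    using G ic Gc
    by (intro integral_FTC_Icc_real rt)
      (auto intro!: derivative_eq_intros continuous_intros simp del: of_nat_Suc power_Suc)
  finally show ?thesis using B[OF rt] by simp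
qed

text \<open>Boundedness on a set of finite measure; this supplies the hypothesis of Fubini's
  theorem.\<close>

lemma (in prob_space) integrable_strip:
  fixes g :: "'a \<Rightarrow> real \<Rightarrow> real"
  assumes [measurable]: "case_prod g \<in> borel_measurable (M \<Otimes>\<^sub>M borel)"
    and K: "\<And>\<omega> s. \<omega> \<in> space M \<Longrightarrow> a \<le> s \<Longrightarrow> s \<le> b \<Longrightarrow> \<bar>g \<omega> s\<bar> \<le> K"
  shows "integrable (M \<Otimes>\<^sub>M lborel) (\<lambda>(\<omega>, s). indicator {a..b} s * g \<omega> s)"
proof (rule Bochner_Integration.integrable_bound)
  have "emeasure (M \<Otimes>\<^sub>M lborel) (space M \<times> {a..b}) < \<infinity>"
    by (subst lborel.emeasure_pair_measure_Times) (auto simp: emeasure_space_1 emeasure_lborel_Icc_eq)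
  then show "integrable (M \<Otimes>\<^sub>M lborel) (\<lambda>p. K * indicator (space M \<times> {a..b}) p)"
    by (intro integrable_mult_right integrable_real_indicator) auto
  show "(\<lambda>(\<omega>, s). indicator {a..b} s * g \<omega> s) \<in> borel_measurable (M \<Otimes>\<^sub>M lborel)"
    by measurable
  show "AE p in M \<Otimes>\<^sub>M lborel. norm (case p of (\<omega>, s) \<Rightarrow> indicator {a..b} s * g \<omega> s)
      \<le> norm (K * indicator (space M \<times> {a..b}) p)"
    using K by (intro AE_I2) (auto simp: space_pair_measure indicator_def intro: order_trans[OF _ abs_ge_self])
qed

text \<open>The Markov property is an integral identity against bounded weights \<open>Z\<close>
  known at time \<open>r\<close>, which replaces conditional expectations and fits the induction on
  the order of moments. Continuity is demanded of every path.\<close>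

locale gaussian_markov = gaussian_kernel v m t c + prob_space M
  for v m t c and M :: "'a measure" +
  fixes F :: "real \<Rightarrow> 'a measure" and X :: "real \<Rightarrow> 'a \<Rightarrow> real"
  assumes subalg: "\<And>s. 0 \<le> s \<Longrightarrow> subalgebra M (F s)"
    and filt_mono: "\<And>r s. 0 \<le> r \<Longrightarrow> r \<le> s \<Longrightarrow> sets (F r) \<subseteq> sets (F s)"
    and adapted: "\<And>s. 0 \<le> s \<Longrightarrow> X s \<in> borel_measurable (F s)"
    and cont: "\<And>\<omega>. \<omega> \<in> space M \<Longrightarrow> continuous_on {0..} (\<lambda>s. X s \<omega>)"
    and markov: "\<And>r s Z B \<phi> K. 0 \<le> r \<Longrightarrow> r < s \<Longrightarrow> s \<le> t \<Longrightarrow> Z \<in> borel_measurable (F r) \<Longrightarrow>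
       (\<And>\<omega>. \<bar>Z \<omega>\<bar> \<le> B) \<Longrightarrow> \<phi> \<in> borel_measurable borel \<Longrightarrow> (\<And>w. \<bar>\<phi> w\<bar> \<le> K) \<Longrightarrow>
       (LINT \<omega>|M. Z \<omega> * \<phi> (X s \<omega>)) = (LINT \<omega>|M. Z \<omega> * transition r s \<phi> (X r \<omega>))"
begin

lemma X_measurable: "0 \<le> s \<Longrightarrow> X s \<in> borel_measurable M"
  using adapted subalg measurable_from_subalg by blast

lemma X_pair_measurable [measurable (raw)]:
  assumes [measurable]: "f \<in> borel_measurable N" "g \<in> measurable N M"
  shows "(\<lambda>x. X (max 0 (f x)) (g x)) \<in> borel_measurable N"
proof -
  have "(\<lambda>x. (\<lambda>(s, \<omega>). X (max 0 s) \<omega>) (f x, g x)) \<in> borel_measurable N"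
    by (rule measurable_compose[OF _ borel_measurable_continuous_process])
      (use X_measurable cont in \<open>measurable\<close>)
  then show ?thesis by simp
qed

lemma transition_prob_bound:
  assumes r: "0 \<le> r" "r < s" "s \<le> t" and [measurable]: "\<phi> \<in> borel_measurable borel" and K: "\<And>w. \<bar>\<phi> w\<bar> \<le> K"
  shows "\<bar>transition r s \<phi> z\<bar> \<le> K"
proof -
  have vp: "0 < v r s" using v_pos r by simp
  have i: "integrable lborel (\<lambda>w. q r z s w)" "(LINT w|lborel. q r z s w) = 1"
    using heat_kernel_has_bochner_integral[OF vp] by (simp_all add: q_def has_bochner_integral_iff)
  have "0 \<le> q r z s w" for w using vp by (simp add: q_def heat_kernel_nonneg)
  then have "\<bar>LINT w|lborel. 1 * (q r z s w * \<phi> w)\<bar> \<le> 1 * 1 * K"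
    using i by (intro integral_product_bound(2) K) auto
  then show ?thesis by (simp add: transition_def)
qed

context
  fixes f :: "real \<Rightarrow> real" and C :: real
  assumes f_cont: "continuous_on UNIV f" and f_bound: "\<And>w. \<bar>f w\<bar> \<le> C"
    and f_int: "integrable lborel f" "(LINT w|lborel. \<bar>f w\<bar>) \<le> 2"
begin

lemma f_measurable [measurable]: "f \<in> borel_measurable borel"
  using f_cont by (rule borel_measurable_continuous_onI)

text \<open>A qualitative bound for exchanging integrals; any exponent in (0, 1) would do, and 1/2
  is taken.\<close>

lemma iterated_potential_bounded:
  "\<exists>K. \<forall>r z. 0 \<le> r \<longrightarrow> r \<le> t \<longrightarrow> \<bar>iterated_potential f n r z\<bar> \<le> K"
proof (induction n)
  case (Suc n)
  then obtain K where K: "\<And>r z. 0 \<le> r \<Longrightarrow> r \<le> t \<Longrightarrow> \<bar>iterated_potential f n r z\<bar> \<le> K" by blast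
  have "\<bar>iterated_potential f (Suc n) r z\<bar> \<le> real (Suc n) * (pconst (1/2) * K)" if "0 \<le> r" "r \<le> t" for r z
    unfolding iterated_potential.simps abs_mult abs_of_nat
    using potential_bounds(2)[of "1/2", OF _ _ that f_int iterated_potential_measurable K] by (intro mult_left_mono) auto
  then show ?case by blast
qed auto

text \<open>The part of the additive functional still to come after time \<open>r\<close>.\<close>

definition occ :: "real \<Rightarrow> 'a \<Rightarrow> real" where
  "occ r \<omega> = (LINT s|lborel. indicator {r..t} s * f (X (max 0 s) \<omega>))"

lemma occ_measurable [measurable (raw)]:
  assumes [measurable]: "g \<in> borel_measurable N" "h \<in> measurable N M"
  shows "(\<lambda>x. occ (g x) (h x)) \<in> borel_measurable N"
  unfolding occ_def indicator_def atLeastAtMost_iff by measurable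

lemma occ_bound:
  assumes r: "0 \<le> r" "r \<le> t" shows "\<bar>occ r \<omega>\<bar> \<le> C * t"
proof -
  have C0: "0 \<le> C" using f_bound[of 0] by linarith
  have "norm (occ r \<omega>) \<le> (LINT s|lborel. norm (indicator {r..t} s * f (X (max 0 s) \<omega>)))"
    unfolding occ_def by (rule integral_norm_bound)
  also have "\<dots> \<le> (LINT s|lborel. C * indicator {r..t} s)"
  proof (rule integral_mono')
    show "integrable lborel (\<lambda>s. C * indicator {r..t} s)"
      by (intro integrable_mult_right integrable_real_indicator) (auto simp: emeasure_lborel_Icc_eq)
  qed (use f_bound C0 in \<open>auto simp: indicator_def\<close>)
  also have "\<dots> \<le> C * t" using r C0 by (simp add: mult_left_mono)
  finally show ?thesis by simp
qed

lemma occ_power: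
  assumes "\<omega> \<in> space M" "r \<le> t"
  shows "occ r \<omega> ^ Suc n = (LINT s|lborel. indicator {r..t} s * (real (Suc n) * (f (X (max 0 s) \<omega>) * occ s \<omega> ^ n)))"
proof -
  have "continuous_on UNIV (\<lambda>s. f (X (max 0 s) \<omega>))"
    by (rule continuous_on_compose2[OF f_cont, OF continuous_on_compose2[OF cont[OF assms(1)]]])
      (auto intro!: continuous_intros)
  from power_of_integral[OF this assms(2)] show ?thesis unfolding occ_def by simp
qed

text \<open>The weight \<open>Z\<close> makes the induction close. Once the earliest time s is
  isolated, the induction hypothesis is applied at s with weight Z f(X_s), and the Markov property
  brings the result back from s to r; Fubini's theorem is used before and after.\<close>

lemma expectation_occ_power:
  assumes "0 \<le> r" "r \<le> t" "Z \<in> borel_measurable (F r)" "\<And>\<omega>. \<bar>Z \<omega>\<bar> \<le> B"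
  shows "(LINT \<omega>|M. Z \<omega> * occ r \<omega> ^ n) = (LINT \<omega>|M. Z \<omega> * iterated_potential f n r (X r \<omega>))"
  using assms
proof (induction n arbitrary: r Z B)
  case (Suc n)
  note r = Suc.prems(1,2) and ZF = Suc.prems(3) and ZB = Suc.prems(4)
  interpret P: pair_sigma_finite M lborel ..
  have Zm[measurable]: "Z \<in> borel_measurable M"
    using ZF subalg[OF r(1)] measurable_from_subalg by blast
  have B0: "0 \<le> B" using ZB[of undefined] by linarith
  have C0: "0 \<le> C" using f_bound[of 0] by linarith
  obtain K where K: "\<And>r z. 0 \<le> r \<Longrightarrow> r \<le> t \<Longrightarrow> \<bar>iterated_potential f n r z\<bar> \<le> K"
    using iterated_potential_bounded by blast
  have K0: "0 \<le> K" using K[OF r, of 0] by linarith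
  let ?u = "iterated_potential f n"
  let ?g = "\<lambda>\<omega> s. real (Suc n) * (Z \<omega> * f (X (max 0 s) \<omega>) * occ s \<omega> ^ n)"
  let ?h = "\<lambda>\<omega> s. indicator {r<..t} s * (real (Suc n) * (Z \<omega> * transition r s (\<lambda>w. f w * ?u s w) (X r \<omega>)))"
  have Xr[measurable]: "X r \<in> borel_measurable M" using X_measurable r by blast
  have um[measurable]: "?u s \<in> borel_measurable borel" for s
    by (rule measurable_compose[OF _ iterated_potential_measurable[OF f_measurable], of "\<lambda>w. (s, w)", simplified]) measurable
  have "(LINT \<omega>|M. Z \<omega> * occ r \<omega> ^ Suc n) = (LINT \<omega>|M. LINT s|lborel. indicator {r..t} s * ?g \<omega> s)"
  proof (rule Bochner_Integration.integral_cong[OF refl])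
    fix \<omega> assume "\<omega> \<in> space M"
    then have "Z \<omega> * occ r \<omega> ^ Suc n = Z \<omega> * (LINT s|lborel. indicator {r..t} s * (real (Suc n) * (f (X (max 0 s) \<omega>) * occ s \<omega> ^ n)))"
      by (simp only: occ_power[OF _ r(2)])
    also have "\<dots> = (LINT s|lborel. Z \<omega> * (indicator {r..t} s * (real (Suc n) * (f (X (max 0 s) \<omega>) * occ s \<omega> ^ n))))"
      by (rule integral_mult_right_zero[symmetric])
    also have "\<dots> = (LINT s|lborel. indicator {r..t} s * ?g \<omega> s)"
      by (intro Bochner_Integration.integral_cong) (simp_all only: mult_ac)
    finally show "Z \<omega> * occ r \<omega> ^ Suc n = (LINT s|lborel. indicator {r..t} s * ?g \<omega> s)" .
  qed
  also have "\<dots> = (LINT s|lborel. LINT \<omega>|M. indicator {r..t} s * ?g \<omega> s)"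
  proof (rule P.Fubini_integral[symmetric], rule integrable_strip)
    show "\<bar>?g \<omega> s\<bar> \<le> real (Suc n) * (B * C * (C * t) ^ n)" if "r \<le> s" "s \<le> t" for \<omega> s
      unfolding abs_mult abs_of_nat power_abs
      using that r B0 C0 t_pos by (intro mult_left_mono mult_mono power_mono ZB f_bound occ_bound) auto
  qed measurable
  also have "\<dots> = (LINT s|lborel. LINT \<omega>|M. indicator {r..t} s * ?h \<omega> s)"
  proof (rule integral_cong_AE)
    show "(\<lambda>s. LINT \<omega>|M. indicator {r..t} s * ?g \<omega> s) \<in> borel_measurable lborel"
      by measurable
    show "(\<lambda>s. LINT \<omega>|M. indicator {r..t} s * ?h \<omega> s) \<in> borel_measurable lborel"
      by measurable
    \<comment> \<open>At s = r, where the Markov property does not apply, the two sides may differ;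
      a single time is a null set.\<close>
    show "AE s in lborel. (LINT \<omega>|M. indicator {r..t} s * ?g \<omega> s) = (LINT \<omega>|M. indicator {r..t} s * ?h \<omega> s)"
      using AE_lborel_singleton[of r]
    proof eventually_elim
      case (elim s)
      show ?case
      proof (cases "s \<in> {r<..t}")
        case True
        then have s: "0 \<le> s" "s \<le> t" "r < s" using r by auto
        have sub: "sets (F r) \<subseteq> sets (F s)" "space (F r) = space (F s)"
          using filt_mono[of r s] r s subalg[of r] subalg[of s] by (auto simp: subalgebra_def)
        have ZFs[measurable]: "Z \<in> borel_measurable (F s)"
          using ZF sub by (auto simp: measurable_def)
        have [measurable]: "X s \<in> borel_measurable (F s)" using adapted s by simp
        have "(LINT \<omega>|M. Z \<omega> * f (X s \<omega>) * occ s \<omega> ^ n) = (LINT \<omega>|M. Z \<omega> * f (X s \<omega>) * ?u s (X s \<omega>))"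
        proof (rule Suc.IH[OF s(1,2)])
          show "\<bar>Z \<omega> * f (X s \<omega>)\<bar> \<le> B * C" for \<omega>
            unfolding abs_mult by (intro mult_mono ZB f_bound B0) auto
        qed measurable
        also have "\<dots> = (LINT \<omega>|M. Z \<omega> * (\<lambda>w. f w * ?u s w) (X s \<omega>))" by (simp add: mult.assoc)
        also have "\<dots> = (LINT \<omega>|M. Z \<omega> * transition r s (\<lambda>w. f w * ?u s w) (X r \<omega>))"
        proof (rule markov[OF r(1) s(3,2) ZF ZB, where K = "C * K"])
          show "\<bar>f w * ?u s w\<bar> \<le> C * K" for w
            unfolding abs_mult using s by (intro mult_mono f_bound K C0) auto
        qed measurable
        finally show ?thesis using True s by simp
      qed (use elim in \<open>auto simp: indicator_def\<close>)
    qed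
  qed
  also have "\<dots> = (LINT \<omega>|M. LINT s|lborel. indicator {r..t} s * ?h \<omega> s)"
  proof (rule P.Fubini_integral, rule integrable_strip)
    fix \<omega> s assume s: "r \<le> s" "s \<le> t"
    show "\<bar>?h \<omega> s\<bar> \<le> real (Suc n) * (B * (C * K))"
    proof (cases "r < s")
      case True
      have "\<bar>transition r s (\<lambda>w. f w * ?u s w) (X r \<omega>)\<bar> \<le> C * K"
      proof (rule transition_prob_bound[OF r(1) True s(2)])
        show "\<bar>f w * ?u s w\<bar> \<le> C * K" for w
          unfolding abs_mult using s r by (intro mult_mono f_bound K C0) auto
      qed measurable
      then have "\<bar>real (Suc n) * (Z \<omega> * transition r s (\<lambda>w. f w * ?u s w) (X r \<omega>))\<bar> \<le> real (Suc n) * (B * (C * K))"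
        unfolding abs_mult abs_of_nat by (intro mult_left_mono mult_mono ZB B0) auto
      then show ?thesis using True s by simp
    qed (use B0 C0 K0 in simp)
  qed measurable
  also have "\<dots> = (LINT \<omega>|M. Z \<omega> * iterated_potential f (Suc n) r (X r \<omega>))"
  proof (rule Bochner_Integration.integral_cong[OF refl])
    fix \<omega>
    have "(LINT s|lborel. indicator {r..t} s * ?h \<omega> s)
      = (LINT s|lborel. (Z \<omega> * real (Suc n)) * (indicator {r<..t} s * transition r s (\<lambda>w. f w * ?u s w) (X r \<omega>)))"
      by (intro Bochner_Integration.integral_cong) (auto simp: indicator_def)
    also have "\<dots> = (Z \<omega> * real (Suc n)) * (LINT s|lborel. indicator {r<..t} s * transition r s (\<lambda>w. f w * ?u s w) (X r \<omega>))"
      by (rule integral_mult_right_zero)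
    also have "\<dots> = Z \<omega> * iterated_potential f (Suc n) r (X r \<omega>)"
      by (simp only: iterated_potential.simps potential_def mult.assoc)
    finally show "(LINT s|lborel. indicator {r..t} s * ?h \<omega> s) = Z \<omega> * iterated_potential f (Suc n) r (X r \<omega>)" .
  qed
  finally show ?case .
qed simp

end

text \<open>The moment identity at r = 0 with Z = 1. The bound \<open>C\<close> of the test function
  blows up with 1/\<epsilon>, but it only certifies integrability; the right-hand side comes from
  the potentials.\<close>

lemma local_time_increment_moment:
  assumes \<epsilon>: "0 < \<epsilon>" and \<theta>: "0 < \<theta>" "\<theta> < 1"
  shows "(\<integral>\<^sup>+\<omega>. ennreal ((LINT s|lborel. indicator {0..t} s * heat_diff \<epsilon> x y (X (max 0 s) \<omega>)) ^ (2 * k)) \<partial>M)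
    \<le> ennreal (fact (2 * k) * pconst \<theta> ^ (2 * k) * (\<bar>x - y\<bar> powr \<theta>) ^ k)"
proof -
  let ?f = "heat_diff \<epsilon> x y"
  define C where "C = 2 * \<epsilon> powr (- 1 / 2)"
  have f1: "continuous_on UNIV ?f"
    unfolding heat_diff_def[abs_def] by (intro continuous_intros \<epsilon>)
  have f2: "\<bar>?f w\<bar> \<le> C" for w
    using heat_kernel_le[OF \<epsilon>, of "w - x"] heat_kernel_le[OF \<epsilon>, of "w - y"] \<epsilon>
      heat_kernel_nonneg[of \<epsilon> "w - x"] heat_kernel_nonneg[of \<epsilon> "w - y"]
    unfolding heat_diff_def C_def by linarith
  note f = f1 f2 heat_diff_integrable[OF \<epsilon>, of x y]
  note [measurable] = occ_measurable[OF f]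
  let ?Z = "\<lambda>\<omega>. occ ?f 0 \<omega> ^ (2 * k)"
  let ?D = "fact (2 * k) * pconst \<theta> ^ (2 * k) * (\<bar>x - y\<bar> powr \<theta>) ^ k"
  have X0[measurable]: "X 0 \<in> borel_measurable M" using X_measurable by simp
  have um[measurable]: "iterated_potential ?f (2 * k) 0 \<in> borel_measurable borel"
    by (rule measurable_compose[OF _ iterated_potential_measurable[OF heat_diff_measurable], of "\<lambda>w. (0, w)", simplified]) measurable
  have ub: "\<bar>iterated_potential ?f (2 * k) 0 z\<bar> \<le> ?D" for z
    using t_pos by (intro iterated_potential_even_bound \<theta> \<epsilon>) auto
  have D0: "0 \<le> ?D" using ub[of 0] by linarith
  have "integrable M ?Z"
  proof (rule integrable_const_bound)
    show "AE \<omega> in M. norm (?Z \<omega>) \<le> (C * t) ^ (2 * k)"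
      unfolding norm_power using power_mono[OF occ_bound[OF f, of 0] abs_ge_zero, of _ "2 * k"] t_pos
      by (intro AE_I2) simp
  qed measurable
  then have "(\<integral>\<^sup>+\<omega>. ennreal (?Z \<omega>) \<partial>M) = ennreal (LINT \<omega>|M. ?Z \<omega>)"
    by (intro nn_integral_eq_integral) auto
  also have "(LINT \<omega>|M. ?Z \<omega>) = (LINT \<omega>|M. iterated_potential ?f (2 * k) 0 (X 0 \<omega>))"
    using expectation_occ_power[OF f, of 0 "\<lambda>_. 1" 1 "2 * k"] t_pos by simp
  also have "\<dots> \<le> ?D"
  proof (rule integral_le_const)
    show "integrable M (\<lambda>\<omega>. iterated_potential ?f (2 * k) 0 (X 0 \<omega>))"
      by (rule integrable_const_bound[where B = ?D]) (use ub in auto)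
    show "AE \<omega> in M. iterated_potential ?f (2 * k) 0 (X 0 \<omega>) \<le> ?D"
      by (intro AE_I2 order_trans[OF abs_ge_self ub])
  qed
  finally show ?thesis using D0 by (simp add: occ_def[OF f] ennreal_leI)
qed

end

section \<open>Gaussian transitions of the linear equation\<close>

definition grid :: "real \<Rightarrow> real \<Rightarrow> nat \<Rightarrow> nat \<Rightarrow> real" where
  "grid r s n i = r + real i * ((s - r) / real n)"

lemma grid_props:
  assumes "r \<le> s" "i < n"
  shows "r \<le> grid r s n i" "grid r s n i \<le> grid r s n (Suc i)" "grid r s n (Suc i) \<le> s"
    "grid r s n (Suc i) - grid r s n i = (s - r) / real n"
proof -
  have "real (Suc i) * ((s - r) / real n) \<le> real n * ((s - r) / real n)"
    using assms by (intro mult_right_mono) auto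
  then show "grid r s n (Suc i) \<le> s" using assms by (simp add: grid_def)
qed (use assms in \<open>auto simp: grid_def distrib_right add_divide_distrib\<close>)

lemma grid_ends: "grid r s n 0 = r" "0 < n \<Longrightarrow> grid r s n n = s"
  by (simp_all add: grid_def)

lemma grid_mesh_eventually:
  assumes "0 < \<delta>" shows "\<forall>\<^sub>F n in sequentially. 0 < n \<and> (s - r) / real n < \<delta>"
proof -
  have "(\<lambda>n. (s - r) / real n) \<longlonglongrightarrow> 0" by (rule lim_const_over_n)
  then have "\<forall>\<^sub>F n in sequentially. (s - r) / real n < \<delta>" using assms order_tendstoD(2) by blast
  then show ?thesis using eventually_gt_at_top[of 0] by eventually_elim simp
qed

text \<open>A sewing principle: local errors that are small multiples of the increments of
  \<open>G\<close> telescope to a small total error. It is used with the identity as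
  \<open>G\<close> for Riemann sums and with an exponential weight for the drift.\<close>

lemma sum_local_error_tendsto:
  fixes \<sigma> :: "real \<Rightarrow> real \<Rightarrow> real" and \<Phi> G :: "real \<Rightarrow> real"
  assumes rs: "r \<le> s"
    and G: "G r \<le> G s"
    and err: "\<And>\<eta>. 0 < \<eta> \<Longrightarrow> \<exists>\<delta>>0. \<forall>a b. r \<le> a \<and> a \<le> b \<and> b \<le> s \<and> b - a < \<delta> \<longrightarrow>
      \<bar>\<sigma> a b - (\<Phi> b - \<Phi> a)\<bar> \<le> \<eta> * (G b - G a)"
  shows "(\<lambda>n. \<Sum>i<n. \<sigma> (grid r s n i) (grid r s n (Suc i))) \<longlonglongrightarrow> \<Phi> s - \<Phi> r"
proof (rule tendstoI)
  fix e :: real assume e: "0 < e"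
  \<comment> \<open>The added 1 keeps the denominator positive when
    \<open>G s = G r\<close>.\<close>
  define \<eta> where "\<eta> = e / (G s - G r + 1)"
  have \<eta>: "0 < \<eta>" "\<eta> * (G s - G r) < e" using e G by (auto simp: \<eta>_def field_simps)
  obtain \<delta> where \<delta>: "0 < \<delta>" "\<And>a b. r \<le> a \<Longrightarrow> a \<le> b \<Longrightarrow> b \<le> s \<Longrightarrow> b - a < \<delta> \<Longrightarrow>
      \<bar>\<sigma> a b - (\<Phi> b - \<Phi> a)\<bar> \<le> \<eta> * (G b - G a)" using err[OF \<eta>(1)] by blast
  show "\<forall>\<^sub>F n in sequentially. dist (\<Sum>i<n. \<sigma> (grid r s n i) (grid r s n (Suc i))) (\<Phi> s - \<Phi> r) < e"
    using grid_mesh_eventually[OF \<delta>(1), of s r]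
  proof eventually_elim
    case (elim n)
    let ?p = "grid r s n"
    have tele: "f s - f r = (\<Sum>i<n. f (?p (Suc i)) - f (?p i))" for f :: "real \<Rightarrow> real"
      using elim by (simp only: sum_lessThan_telescope[of "\<lambda>i. f (?p i)"] grid_ends)
    have "\<bar>(\<Sum>i<n. \<sigma> (?p i) (?p (Suc i))) - (\<Phi> s - \<Phi> r)\<bar>
      = \<bar>\<Sum>i<n. \<sigma> (?p i) (?p (Suc i)) - (\<Phi> (?p (Suc i)) - \<Phi> (?p i))\<bar>"
      by (simp only: tele[of \<Phi>] sum_subtractf)
    also have "\<dots> \<le> (\<Sum>i<n. \<eta> * (G (?p (Suc i)) - G (?p i)))"
      using elim grid_props[OF rs, of _ n]
      by (intro order_trans[OF sum_abs] sum_mono \<delta>(2)) auto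
    also have "\<dots> = \<eta> * (G s - G r)" by (simp only: tele[of G] sum_distrib_left)
    finally show ?case using \<eta>(2) by (simp add: dist_real_def)
  qed
qed

lemma Riemann_sum_tendsto_integral:
  fixes g :: "real \<Rightarrow> real"
  assumes rs: "r \<le> s" and g: "continuous_on {r..s} g"
  shows "(\<lambda>n. \<Sum>i<n. g (grid r s n i) * (grid r s n (Suc i) - grid r s n i)) \<longlonglongrightarrow> integral {r..s} g"
proof -
  have gi: "g integrable_on {a..b}" if "r \<le> a" "b \<le> s" for a b
    using that by (intro integrable_continuous_interval continuous_on_subset[OF g]) auto
  have "(\<lambda>n. \<Sum>i<n. g (grid r s n i) * (grid r s n (Suc i) - grid r s n i)) \<longlonglongrightarrow>
    integral {r..s} g - integral {r..r} g"
  proof (rule sum_local_error_tendsto[OF rs, where G = "\<lambda>x. x" and \<Phi> = "\<lambda>x. integral {r..x} g"])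
    fix \<eta> :: real assume \<eta>: "0 < \<eta>"
    have "uniformly_continuous_on {r..s} g" using g by (intro compact_uniformly_continuous) auto
    then obtain \<delta> where \<delta>: "0 < \<delta>" "\<And>x y. x \<in> {r..s} \<Longrightarrow> y \<in> {r..s} \<Longrightarrow> dist y x < \<delta> \<Longrightarrow> dist (g y) (g x) < \<eta>"
      unfolding uniformly_continuous_on_def using \<eta> by metis
    show "\<exists>\<delta>>0. \<forall>a b. r \<le> a \<and> a \<le> b \<and> b \<le> s \<and> b - a < \<delta> \<longrightarrow>
      \<bar>g a * (b - a) - (integral {r..b} g - integral {r..a} g)\<bar> \<le> \<eta> * (b - a)"
    proof (intro exI[of _ \<delta>] conjI \<delta>(1) allI impI)
      fix a b assume ab: "r \<le> a \<and> a \<le> b \<and> b \<le> s \<and> b - a < \<delta>"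
      have "integral {r..b} g - integral {r..a} g = integral {a..b} g"
        using Henstock_Kurzweil_Integration.integral_combine[of r a b g] ab gi by auto
      also have "g a * (b - a) - integral {a..b} g = integral {a..b} (\<lambda>x. g a - g x)"
        using ab gi by (subst Henstock_Kurzweil_Integration.integral_diff) auto
      also have "\<bar>\<dots>\<bar> \<le> integral {a..b} (\<lambda>x. \<eta>)"
      proof -
        have "norm (integral {a..b} (\<lambda>x. g a - g x)) \<le> integral {a..b} (\<lambda>x. \<eta>)"
          using ab gi \<delta>(2)[of a]
          by (intro integral_norm_bound_integral integrable_diff)
            (auto simp: dist_real_def abs_minus_commute intro!: less_imp_le)
        then show ?thesis by simp
      qed
      also have "\<dots> = \<eta> * (b - a)" using ab by simp
      finally show "\<bar>g a * (b - a) - (integral {r..b} g - integral {r..a} g)\<bar> \<le> \<eta> * (b - a)" .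
    qed
  qed (use rs in auto)
  then show ?thesis by simp
qed

text \<open>Tangent inequalities of exp at both endpoints. The remainder is bounded by an increment
  of exp times the step, a form whose sum telescopes.\<close>

lemma exp_increment_bounds:
  fixes a b :: real
  assumes "a \<le> b"
  shows "0 \<le> exp b - exp a - exp a * (b - a)" "exp b - exp a - exp a * (b - a) \<le> (exp b - exp a) * (b - a)"
proof -
  have "exp a * (1 + (b - a)) \<le> exp a * exp (b - a)" by (intro mult_left_mono exp_ge_add_one_self) auto
  then show "0 \<le> exp b - exp a - exp a * (b - a)" by (simp add: exp_diff distrib_left)
  have "exp b * (1 + (a - b)) \<le> exp b * exp (a - b)" by (intro mult_left_mono exp_ge_add_one_self) auto
  then show "exp b - exp a - exp a * (b - a) \<le> (exp b - exp a) * (b - a)" by (simp add: exp_diff algebra_simps)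
qed

text \<open>Summation by parts along the grid: the exponential weights absorb the drift up to an error of
  higher order, so the linear equation need not be solved explicitly.\<close>

lemma linear_drift_weighted_sums:
  fixes \<alpha> x w :: "real \<Rightarrow> real"
  defines "A \<equiv> \<lambda>u. integral {0..u} \<alpha>"
  assumes rs: "0 \<le> r" "r \<le> s"
    and \<alpha>: "\<And>u. 0 \<le> u \<Longrightarrow> 0 \<le> \<alpha> u" "\<alpha> integrable_on {0..s}"
    and x: "continuous_on {0..s} x" and \<alpha>x: "(\<lambda>u. \<alpha> u * x u) integrable_on {0..s}"
    and eq: "\<And>u. 0 \<le> u \<Longrightarrow> u \<le> s \<Longrightarrow> x u = - integral {0..u} (\<lambda>u. \<alpha> u * x u) + w u"
  shows "(\<lambda>n. \<Sum>i<n. exp (- (A s - A (grid r s n i))) * (w (grid r s n (Suc i)) - w (grid r s n i)))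
    \<longlonglongrightarrow> x s - exp (- (A s - A r)) * x r"
proof -
  define E where "E u = exp (- (A s - A u))" for u
  have sub: "f integrable_on {a..b}" if "f integrable_on {0..s}" "0 \<le> a" "b \<le> s" for f :: "real \<Rightarrow> real" and a b
    using that by (elim integrable_on_subinterval) auto
  have diff: "integral {0..b} f - integral {0..a} f = integral {a..b} f"
    if "f integrable_on {0..s}" "0 \<le> a" "a \<le> b" "b \<le> s" for f :: "real \<Rightarrow> real" and a b
    using Henstock_Kurzweil_Integration.integral_combine[of 0 a b f] sub[OF that(1)] that by auto
  have Adiff: "A b - A a = integral {a..b} \<alpha>" if "0 \<le> a" "a \<le> b" "b \<le> s" for a b
    unfolding A_def using diff[OF \<alpha>(2) that] .
  have Amono: "A a \<le> A b" if "0 \<le> a" "a \<le> b" "b \<le> s" for a b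
    using Adiff[OF that] integral_nonneg[OF sub[OF \<alpha>(2)], of a b] that \<alpha>(1) by auto
  have E1: "E u \<le> 1" if "0 \<le> u" "u \<le> s" for u using Amono[of u s] that by (simp add: E_def)
  have Ac: "continuous_on {0..s} A" unfolding A_def by (rule indefinite_integral_continuous_1[OF \<alpha>(2)])
  have "bounded (x ` {0..s})" using x by (intro compact_imp_bounded compact_continuous_image) auto
  then obtain K where K: "0 < K" "\<And>u. 0 \<le> u \<Longrightarrow> u \<le> s \<Longrightarrow> \<bar>x u\<bar> \<le> K" unfolding bounded_pos by auto
  have unif: "\<exists>\<delta>>0. \<forall>a b. 0 \<le> a \<and> a \<le> b \<and> b \<le> s \<and> b - a < \<delta> \<longrightarrow> \<bar>f b - f a\<bar> < \<eta>"
    if "continuous_on {0..s} f" "0 < \<eta>" for f :: "real \<Rightarrow> real" and \<eta>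
  proof -
    have "uniformly_continuous_on {0..s} f" using that by (intro compact_uniformly_continuous) auto
    then obtain \<delta> where \<delta>: "0 < \<delta>" "\<And>x y. x \<in> {0..s} \<Longrightarrow> y \<in> {0..s} \<Longrightarrow> dist y x < \<delta> \<Longrightarrow> dist (f y) (f x) < \<eta>"
      unfolding uniformly_continuous_on_def using \<open>0 < \<eta>\<close> by metis
    show ?thesis
    proof (intro exI[of _ \<delta>] conjI \<delta>(1) allI impI)
      fix a b assume ab: "0 \<le> a \<and> a \<le> b \<and> b \<le> s \<and> b - a < \<delta>"
      then show "\<bar>f b - f a\<bar> < \<eta>" using \<delta>(2)[of a b] by (auto simp: dist_real_def)
    qed
  qed
  \<comment> \<open>\<open>E\<close> is the integrating factor of the drift. Its increments, scaled
    by the bound \<open>K\<close> of the path, together with those of \<open>A\<close> control the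
    local error.\<close>
  have "(\<lambda>n. \<Sum>i<n. E (grid r s n i) * (w (grid r s n (Suc i)) - w (grid r s n i))) \<longlonglongrightarrow> E s * x s - E r * x r"
  proof (rule sum_local_error_tendsto[OF rs(2), where G = "\<lambda>u. K * E u + A u" and \<Phi> = "\<lambda>u. E u * x u"])
    show "K * E r + A r \<le> K * E s + A s"
      using Amono[OF rs order_refl] K(1) by (intro add_mono mult_left_mono) (auto simp: E_def)
    fix \<eta> :: real assume \<eta>: "0 < \<eta>"
    obtain \<delta>1 where \<delta>1: "0 < \<delta>1" "\<And>a b. 0 \<le> a \<Longrightarrow> a \<le> b \<Longrightarrow> b \<le> s \<Longrightarrow> b - a < \<delta>1 \<Longrightarrow> \<bar>x b - x a\<bar> < \<eta>"
      using unif[OF x \<eta>] by blast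
    obtain \<delta>2 where \<delta>2: "0 < \<delta>2" "\<And>a b. 0 \<le> a \<Longrightarrow> a \<le> b \<Longrightarrow> b \<le> s \<Longrightarrow> b - a < \<delta>2 \<Longrightarrow> \<bar>A b - A a\<bar> < \<eta>"
      using unif[OF Ac \<eta>] by blast
    show "\<exists>\<delta>>0. \<forall>a b. r \<le> a \<and> a \<le> b \<and> b \<le> s \<and> b - a < \<delta> \<longrightarrow>
      \<bar>E a * (w b - w a) - (E b * x b - E a * x a)\<bar> \<le> \<eta> * (K * E b + A b - (K * E a + A a))"
    proof (intro exI[of _ "min \<delta>1 \<delta>2"] conjI allI impI)
      fix a b assume h: "r \<le> a \<and> a \<le> b \<and> b \<le> s \<and> b - a < min \<delta>1 \<delta>2"
      then have ab: "0 \<le> a" "a \<le> b" "b \<le> s" "b - a < \<delta>1" "b - a < \<delta>2" using rs by auto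
      have dA: "0 \<le> A b - A a" "A b - A a \<le> \<eta>" using Amono[OF ab(1-3)] \<delta>2(2)[OF ab(1-3,5)] by auto
      let ?J = "integral {a..b} (\<lambda>u. \<alpha> u * (x b - x u))"
      have J: "?J = (A b - A a) * x b - integral {a..b} (\<lambda>u. \<alpha> u * x u)"
        using sub[OF \<alpha>(2), of a b] sub[OF \<alpha>x, of a b] ab Adiff[OF ab(1-3)]
        by (simp add: right_diff_distrib Henstock_Kurzweil_Integration.integral_diff integrable_on_mult_left)
      have "norm ?J \<le> integral {a..b} (\<lambda>u. \<eta> * \<alpha> u)"
      proof (rule integral_norm_bound_integral)
        show "(\<lambda>u. \<alpha> u * (x b - x u)) integrable_on {a..b}"
          using sub[OF \<alpha>(2), of a b] sub[OF \<alpha>x, of a b] ab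
          by (simp add: right_diff_distrib integrable_diff integrable_on_mult_left)
        show "(\<lambda>u. \<eta> * \<alpha> u) integrable_on {a..b}" using sub[OF \<alpha>(2), of a b] ab by (simp add: integrable_on_mult_right)
        fix u assume "u \<in> {a..b}"
        then have "\<bar>x b - x u\<bar> \<le> \<eta>" "0 \<le> \<alpha> u" using ab \<delta>1(2)[of u b] \<alpha>(1)[of u] by auto
        then have "\<alpha> u * \<bar>x b - x u\<bar> \<le> \<alpha> u * \<eta>" by (intro mult_left_mono)
        then show "norm (\<alpha> u * (x b - x u)) \<le> \<eta> * \<alpha> u" using \<open>0 \<le> \<alpha> u\<close> by (simp add: abs_mult mult.commute)
      qed
      then have Jb: "\<bar>?J\<bar> \<le> \<eta> * (A b - A a)" using Adiff[OF ab(1-3)] by simp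
      have "w b - w a = x b - x a + integral {a..b} (\<lambda>u. \<alpha> u * x u)"
        using eq[of a] eq[of b] ab diff[OF \<alpha>x ab(1-3)] by auto
      then have "E a * (w b - w a) = E a * (x b - x a + integral {a..b} (\<lambda>u. \<alpha> u * x u))" by simp
      \<comment> \<open>The error has two sources: the second-order remainder of the exponential,
        and the oscillation of the path within [a, b], collected in \<open>?J\<close>.\<close>
      then have "E a * (w b - w a) - (E b * x b - E a * x a)
        = - ((E b - E a - E a * (A b - A a)) * x b + E a * ?J)"
        unfolding J by (simp add: algebra_simps)
      also have "\<bar>\<dots>\<bar> \<le> \<bar>(E b - E a - E a * (A b - A a)) * x b\<bar> + \<bar>E a * ?J\<bar>"
        unfolding abs_minus_cancel by (rule abs_triangle_ineq)
      also have "\<dots> \<le> (E b - E a) * \<eta> * K + 1 * (\<eta> * (A b - A a))"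
      proof (rule add_mono)
        have ex: "0 \<le> E b - E a - E a * (A b - A a)" "E b - E a - E a * (A b - A a) \<le> (E b - E a) * (A b - A a)"
          using exp_increment_bounds[of "- (A s - A a)" "- (A s - A b)"] dA(1) by (simp_all add: E_def)
        have Eab: "0 \<le> E b - E a" using dA(1) by (simp add: E_def)
        have "\<bar>E b - E a - E a * (A b - A a)\<bar> \<le> (E b - E a) * \<eta>"
          using ex mult_left_mono[OF dA(2) Eab] by linarith
        then show "\<bar>(E b - E a - E a * (A b - A a)) * x b\<bar> \<le> (E b - E a) * \<eta> * K"
          unfolding abs_mult using K(2)[of b] ab Eab \<eta> by (intro mult_mono) auto
        show "\<bar>E a * ?J\<bar> \<le> 1 * (\<eta> * (A b - A a))"
          unfolding abs_mult using E1[of a] ab Jb by (intro mult_mono) (auto simp: E_def)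
      qed
      also have "\<dots> = \<eta> * (K * E b + A b - (K * E a + A a))" by (simp add: algebra_simps)
      finally show "\<bar>E a * (w b - w a) - (E b * x b - E a * x a)\<bar> \<le> \<eta> * (K * E b + A b - (K * E a + A a))" .
    qed (use \<delta>1 \<delta>2 in auto)
  qed
  then show ?thesis by (simp add: E_def)
qed


section \<open>Normal laws, characteristic functions and independence\<close>

lemma (in prob_space) integral_iexp_normal:
  assumes \<sigma>: "0 < \<sigma>" and Y: "distributed M lborel Y (normal_density 0 \<sigma>)"
  shows "(CLINT \<omega>|M. iexp (\<xi> * Y \<omega>)) = complex_of_real (exp (- (\<xi>\<^sup>2 * \<sigma>\<^sup>2) / 2))"
proof -
  have d: "distributed M lborel (\<lambda>\<omega>. Y \<omega> / \<sigma>) std_normal_density"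
    using Y normal_standard_normal_convert[OF \<sigma>, of Y 0] by simp
  then have [measurable]: "(\<lambda>\<omega>. Y \<omega> / \<sigma>) \<in> borel_measurable M" using distributed_measurable[OF d] by simp
  have "(CLINT \<omega>|M. iexp (\<xi> * Y \<omega>)) = (CLINT \<omega>|M. iexp ((\<xi> * \<sigma>) * (Y \<omega> / \<sigma>)))" using \<sigma> by simp
  also have "\<dots> = (CLINT y|distr M lborel (\<lambda>\<omega>. Y \<omega> / \<sigma>). iexp ((\<xi> * \<sigma>) * y))"
    by (subst integral_distr) auto
  also have "distr M lborel (\<lambda>\<omega>. Y \<omega> / \<sigma>) = std_normal_distribution"
    using distributed_distr_eq_density[OF d] .
  also have "(CLINT y|std_normal_distribution. iexp ((\<xi> * \<sigma>) * y)) = complex_of_real (exp (- ((\<xi> * \<sigma>)\<^sup>2) / 2))"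
    using fun_cong[OF char_std_normal_distribution, of "\<xi> * \<sigma>"] unfolding char_def .
  finally show ?thesis by (simp add: power_mult_distrib)
qed

text \<open>Passes from independence of families of events, the form provided by the filtration, to
  independence of random variables, the form required by product formulas.\<close>

lemma (in prob_space) indep_set_indep_var:
  assumes ind: "indep_set (sets N) {Y -` A \<inter> space M | A. A \<in> sets T}"
    and N: "subalgebra M N" and Z: "Z \<in> measurable N S" and Y: "Y \<in> measurable M T" and g: "g \<in> measurable T S'"
  shows "indep_var S Z S' (\<lambda>\<omega>. g (Y \<omega>))"
  unfolding indep_var_eq
proof (intro conjI)
  show "random_variable S Z" using measurable_from_subalg[OF N Z] .
  show gY: "random_variable S' (\<lambda>\<omega>. g (Y \<omega>))" using Y g by measurable
  have sp: "space N = space M" using N by (simp add: subalgebra_def)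
  have "sigma_sets (space M) {Z -` A \<inter> space M |A. A \<in> sets S} \<subseteq> sets N"
    unfolding sp[symmetric] using Z by (intro sets.sigma_sets_subset) (auto simp: measurable_sets)
  moreover have "sigma_sets (space M) {(\<lambda>\<omega>. g (Y \<omega>)) -` A \<inter> space M |A. A \<in> sets S'}
    \<subseteq> {Y -` A \<inter> space M |A. A \<in> sets T}"
  proof -
    have "sigma_sets (space M) {(\<lambda>\<omega>. g (Y \<omega>)) -` A \<inter> space M |A. A \<in> sets S'}
      = sets (vimage_algebra (space M) (\<lambda>\<omega>. g (Y \<omega>)) S')"
      by (simp add: sets_vimage_algebra)
    also have "\<dots> = {(\<lambda>\<omega>. g (Y \<omega>)) -` A \<inter> space M |A. A \<in> sets S'}"
      using gY by (intro sets_vimage_algebra2) (auto simp: measurable_def)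
    also have "\<dots> \<subseteq> {Y -` A \<inter> space M |A. A \<in> sets T}"
    proof clarify
      fix A assume "A \<in> sets S'"
      then have "g -` A \<inter> space T \<in> sets T" using g by (rule measurable_sets[rotated])
      moreover have "(\<lambda>\<omega>. g (Y \<omega>)) -` A \<inter> space M = Y -` (g -` A \<inter> space T) \<inter> space M"
        using measurable_space[OF Y] by auto
      ultimately show "\<exists>B. (\<lambda>\<omega>. g (Y \<omega>)) -` A \<inter> space M = Y -` B \<inter> space M \<and> B \<in> sets T" by blast
    qed
    finally show ?thesis .
  qed
  ultimately show "indep_set (sigma_sets (space M) {Z -` A \<inter> space M |A. A \<in> sets S})
     (sigma_sets (space M) {(\<lambda>\<omega>. g (Y \<omega>)) -` A \<inter> space M |A. A \<in> sets S'})"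
    using ind unfolding indep_sets2_eq by (meson subset_iff)
qed

text \<open>Conditionally on each event of the subalgebra, the variable has the characteristic function of the
  normal law, so Levy's uniqueness theorem identifies all its conditional laws.\<close>

lemma (in prob_space) normal_indep_of_char:
  assumes N: "subalgebra M N" and Y[measurable]: "Y \<in> borel_measurable M" and \<sigma>: "0 < \<sigma>"
    and ch: "\<And>B \<xi>. B \<in> sets N \<Longrightarrow>
      (CLINT \<omega>|M. indicator B \<omega> * iexp (\<xi> * Y \<omega>)) = complex_of_real (prob B * exp (- (\<xi>\<^sup>2 * \<sigma>\<^sup>2) / 2))"
  shows "indep_set (sets N) {Y -` A \<inter> space M | A. A \<in> sets borel}"
    and "distributed M lborel Y (normal_density 0 \<sigma>)"
proof -
  define \<nu> where "\<nu> = density lborel (normal_density 0 \<sigma>)"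
  interpret \<nu>: prob_space \<nu> unfolding \<nu>_def by (rule prob_space_normal_density[OF \<sigma>])
  have \<nu>d: "real_distribution \<nu>" by (intro real_distribution.intro real_distribution_axioms.intro \<nu>.prob_space_axioms) (simp_all add: \<nu>_def)
  have "distributed \<nu> lborel (\<lambda>x. x) (normal_density 0 \<sigma>)"
    unfolding distributed_def by (auto simp: \<nu>_def distr_id2)
  then have ch\<nu>: "char \<nu> \<xi> = complex_of_real (exp (- (\<xi>\<^sup>2 * \<sigma>\<^sup>2) / 2))" for \<xi>
    unfolding char_def by (rule \<nu>.integral_iexp_normal[OF \<sigma>])
  have sub: "sets N \<subseteq> sets M" "space N = space M" using N by (auto simp: subalgebra_def)
  have joint: "prob (B \<inter> (Y -` A \<inter> space M)) = prob B * measure \<nu> A" if B: "B \<in> sets N" and A[measurable]: "A \<in> sets borel" for A B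
  \<comment> \<open>Conditioning on \<open>B\<close> requires positive probability; for a null event
    both sides vanish.\<close>
  proof (cases "prob B = 0")
    case True
    have "prob (B \<inter> (Y -` A \<inter> space M)) \<le> prob B" using B sub by (intro finite_measure_mono) auto
    then show ?thesis using True by (simp add: antisym)
  next
    case False
    have BM[measurable]: "B \<in> sets M" using B sub by auto
    have pB: "0 < prob B" using False by (simp add: zero_less_measure_iff)
    define P where "P = uniform_measure M B"
    interpret P: prob_space P unfolding P_def
      using pB by (intro prob_space_uniform_measure) (auto simp: emeasure_eq_measure)
    have Pd: "P = density M (\<lambda>\<omega>. ennreal (indicator B \<omega> / prob B))"
      unfolding P_def uniform_measure_def
    proof (rule density_cong)
      show "AE \<omega> in M. indicator B \<omega> / emeasure M B = ennreal (indicator B \<omega> / prob B)"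
        using pB by (intro AE_I2) (auto simp: emeasure_eq_measure indicator_def divide_ennreal[symmetric])
    qed measurable
    have YP[measurable]: "Y \<in> borel_measurable P" by (simp add: P_def)
    have "real_distribution (distr P borel Y)"
      by (intro real_distribution.intro real_distribution_axioms.intro P.prob_space_distr) simp_all
    moreover have "char (distr P borel Y) = char \<nu>"
    proof
      fix \<xi>
      have "char (distr P borel Y) \<xi> = (CLINT \<omega>|P. iexp (\<xi> * Y \<omega>))"
        unfolding char_def by (subst integral_distr) auto
      also have "\<dots> = (CLINT \<omega>|density M (\<lambda>\<omega>. ennreal (indicator B \<omega> / prob B)). iexp (\<xi> * Y \<omega>))"
        by (simp only: Pd)
      also have "\<dots> = (CLINT \<omega>|M. (indicator B \<omega> / prob B) *\<^sub>R iexp (\<xi> * Y \<omega>))"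
        using pB by (subst integral_density) auto
      also have "\<dots> = (CLINT \<omega>|M. complex_of_real (1 / prob B) * (indicator B \<omega> * iexp (\<xi> * Y \<omega>)))"
        by (intro Bochner_Integration.integral_cong) (auto simp: indicator_def scaleR_conv_of_real)
      also have "\<dots> = complex_of_real (1 / prob B) * complex_of_real (prob B * exp (- (\<xi>\<^sup>2 * \<sigma>\<^sup>2) / 2))"
        by (simp only: integral_mult_right_zero ch[OF B])
      also have "\<dots> = char \<nu> \<xi>" using pB by (simp add: ch\<nu>)
      finally show "char (distr P borel Y) \<xi> = char \<nu> \<xi>" .
    qed
    ultimately have eq: "distr P borel Y = \<nu>" by (intro Levy_uniqueness \<nu>d)
    have "measure \<nu> A = measure P (Y -` A \<inter> space M)"
      unfolding eq[symmetric] by (subst measure_distr) (auto simp: P_def)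
    also have "\<dots> = prob (B \<inter> (Y -` A \<inter> space M)) / prob B"
      unfolding P_def using pB by (subst measure_uniform_measure) (auto simp: emeasure_eq_measure)
    finally show ?thesis using pB by simp
  qed
  \<comment> \<open>The whole space as conditioning event identifies the unconditional law.\<close>
  have pY: "prob (Y -` A \<inter> space M) = measure \<nu> A" if "A \<in> sets borel" for A
    using joint[of "space M" A] that sub(2) sets.top[of N] by (simp add: prob_space Int_commute)
  show "indep_set (sets N) {Y -` A \<inter> space M | A. A \<in> sets borel}"
    using joint pY sub by (intro indep_setI) auto
  have "distr M lborel Y = \<nu>"
  proof (rule measure_eqI)
    fix A assume "A \<in> sets (distr M lborel Y)"
    then have A[measurable]: "A \<in> sets borel" by simp
    show "emeasure (distr M lborel Y) A = emeasure \<nu> A"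
      using pY[OF A] by (subst emeasure_distr) (auto simp: emeasure_eq_measure \<nu>.emeasure_eq_measure)
  qed (simp add: \<nu>_def)
  then show "distributed M lborel Y (normal_density 0 \<sigma>)"
    unfolding distributed_def \<nu>_def by auto
qed

text \<open>Freezing: \<open>U\<close> is treated as a constant while the independent
  \<open>Y\<close> is integrated against its normal density. In the application \<open>U\<close> is
  the predicted mean and \<open>Y\<close> the new noise.\<close>

lemma (in prob_space) integral_indep_normal:
  assumes ind: "indep_set (sets N) {Y -` A \<inter> space M | A. A \<in> sets borel}"
    and Y: "distributed M lborel Y (normal_density 0 (sqrt v))" and v: "0 < v"
    and N: "subalgebra M N" and Z[measurable]: "Z \<in> borel_measurable N" and U[measurable]: "U \<in> borel_measurable N"
    and ZB: "\<And>\<omega>. \<bar>Z \<omega>\<bar> \<le> B" and \<phi>[measurable]: "\<phi> \<in> borel_measurable borel" and K: "\<And>w. \<bar>\<phi> w\<bar> \<le> K"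
  shows "(LINT \<omega>|M. Z \<omega> * \<phi> (U \<omega> + Y \<omega>)) = (LINT \<omega>|M. Z \<omega> * (LINT w|lborel. heat_kernel v (w - U \<omega>) * \<phi> w))"
proof -
  have Ym[measurable]: "Y \<in> borel_measurable M" using distributed_measurable[OF Y] by simp
  have ZUM[measurable]: "Z \<in> borel_measurable M" "U \<in> borel_measurable M"
    using measurable_from_subalg[OF N Z] measurable_from_subalg[OF N U] by simp_all
  \<comment> \<open>\<open>indep_var\<close> takes variables with a common value type, so
    \<open>Y\<close> is padded with a 0 to match the pair of \<open>Z\<close> and
    \<open>U\<close>.\<close>
  let ?p = "\<lambda>\<omega>. (Z \<omega>, U \<omega>)" and ?y = "\<lambda>\<omega>. (Y \<omega>, 0 :: real)"
  let ?BB = "borel \<Otimes>\<^sub>M borel :: (real \<times> real) measure"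
  have "indep_var ?BB ?p ?BB ?y"
    by (rule indep_set_indep_var[OF ind N _ Ym]) measurable
  then have eq: "distr M ?BB ?p \<Otimes>\<^sub>M distr M ?BB ?y = distr M (?BB \<Otimes>\<^sub>M ?BB) (\<lambda>\<omega>. (?p \<omega>, ?y \<omega>))"
    unfolding indep_var_distribution_eq by simp
  interpret D1: prob_space "distr M ?BB ?p" by (rule prob_space_distr) measurable
  interpret D2: prob_space "distr M ?BB ?y" by (rule prob_space_distr) measurable
  interpret D: pair_prob_space "distr M ?BB ?p" "distr M ?BB ?y" ..
  have B0: "0 \<le> B" using ZB[of undefined] by linarith
  \<comment> \<open>Only the values of \<open>Z\<close> are known to be bounded; clamping bounds the
    integrand on the whole product space.\<close>
  define cl where "cl a = max (- B) (min B a)" for a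
  have cl[measurable]: "cl \<in> borel_measurable borel" unfolding cl_def by measurable
  have clb: "\<bar>cl a\<bar> \<le> B" for a using B0 by (auto simp: cl_def)
  have clamp: "cl (Z \<omega>) = Z \<omega>" for \<omega> using ZB[of \<omega>] by (auto simp: cl_def)
  let ?g = "\<lambda>(p, y). cl (fst p) * \<phi> (snd p + fst y)"
  have gm: "?g \<in> borel_measurable (?BB \<Otimes>\<^sub>M ?BB)" by measurable
  have "(LINT \<omega>|M. Z \<omega> * \<phi> (U \<omega> + Y \<omega>)) = (LINT \<omega>|M. ?g (?p \<omega>, ?y \<omega>))" by (simp add: clamp)
  also have "\<dots> = (LINT x|distr M (?BB \<Otimes>\<^sub>M ?BB) (\<lambda>\<omega>. (?p \<omega>, ?y \<omega>)). ?g x)"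
    by (rule integral_distr[OF _ gm, symmetric]) measurable
  also have "\<dots> = (LINT x|(distr M ?BB ?p \<Otimes>\<^sub>M distr M ?BB ?y). ?g x)" by (simp only: eq)
  also have "\<dots> = (LINT p|(distr M ?BB ?p). LINT y|(distr M ?BB ?y). ?g (p, y))"
  proof (rule D.integral_fst'[symmetric])
    have "\<bar>cl a * \<phi> b\<bar> \<le> B * K" for a b
      unfolding abs_mult using B0 by (intro mult_mono K clb) auto
    then show "integrable (distr M ?BB ?p \<Otimes>\<^sub>M distr M ?BB ?y) ?g"
      using gm by (intro D.P.integrable_const_bound[where B = "B * K"]) (auto simp: split_beta')
  qed
  also have "\<dots> = (LINT \<omega>|M. LINT y|(distr M ?BB ?y). ?g (?p \<omega>, y))"
    by (rule integral_distr) measurable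
  also have "\<dots> = (LINT \<omega>|M. Z \<omega> * (LINT w|lborel. heat_kernel v (w - U \<omega>) * \<phi> w))"
  proof (rule Bochner_Integration.integral_cong[OF refl])
    fix \<omega>
    have "(\<lambda>y. cl (Z \<omega>) * \<phi> (U \<omega> + fst y)) \<in> borel_measurable ?BB" by measurable
    then have "(LINT y|(distr M ?BB ?y). ?g (?p \<omega>, y)) = (LINT \<omega>'|M. ?g (?p \<omega>, ?y \<omega>'))"
      by (intro integral_distr) auto
    also have "\<dots> = Z \<omega> * (LINT \<omega>'|M. \<phi> (U \<omega> + Y \<omega>'))"
      by (simp add: clamp)
    also have "(LINT \<omega>'|M. \<phi> (U \<omega> + Y \<omega>')) = (LINT y|distr M lborel Y. \<phi> (U \<omega> + y))"
      by (rule integral_distr[symmetric]) measurable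
    also have "\<dots> = (LINT y|density lborel (normal_density 0 (sqrt v)). \<phi> (U \<omega> + y))"
      by (simp only: distributed_distr_eq_density[OF Y])
    also have "\<dots> = (LINT y|lborel. heat_kernel v y * \<phi> (U \<omega> + y))"
      using v by (subst integral_density) (auto simp: heat_kernel_normal_density)
    also have "\<dots> = (LINT w|lborel. heat_kernel v (w - U \<omega>) * \<phi> w)"
      using lborel_integral_real_affine[of 1 "\<lambda>w. heat_kernel v (w - U \<omega>) * \<phi> w" "U \<omega>"] by simp
    finally show "(LINT y|(distr M ?BB ?y). ?g (?p \<omega>, y)) = Z \<omega> * (LINT w|lborel. heat_kernel v (w - U \<omega>) * \<phi> w)" .
  qed
  finally show ?thesis .
qed

section \<open>Weighted sums of Brownian increments and their limits\<close>

context std_brownian_motion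
begin

lemma increment_measurable:
  assumes "0 \<le> s" "0 \<le> t" shows "(\<lambda>\<omega>. W t \<omega> - W s \<omega>) \<in> borel_measurable M"
  using measurable_from_subalg[OF subalg adapted] assms by (intro borel_measurable_diff) simp_all

lemma filt_measurable:
  assumes "0 \<le> r" "r \<le> s" "Z \<in> measurable (F r) N" shows "Z \<in> measurable (F s) N"
proof -
  have "space (F r) = space (F s)" using subalg[of r] subalg[of s] assms by (auto simp: subalgebra_def)
  then show ?thesis using filt_mono[OF assms(1,2)] assms(3) by (auto simp: measurable_def)
qed

lemma integral_iexp_increment:
  assumes s: "0 \<le> s" "s < t" and Z: "Z \<in> borel_measurable (F s)" and ZB: "\<And>\<omega>. norm (Z \<omega>) \<le> B"
  shows "(CLINT \<omega>|M. Z \<omega> * iexp (\<xi> * (W t \<omega> - W s \<omega>)))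
    = (CLINT \<omega>|M. Z \<omega>) * complex_of_real (exp (- (\<xi>\<^sup>2 * (t - s)) / 2))"
proof -
  let ?Y = "\<lambda>\<omega>. W t \<omega> - W s \<omega>"
  have Y[measurable]: "?Y \<in> borel_measurable M" using s by (intro increment_measurable) auto
  have ZM[measurable]: "Z \<in> borel_measurable M" using measurable_from_subalg[OF subalg[OF s(1)] Z] .
  have iv: "indep_var borel Z borel (\<lambda>\<omega>. iexp (\<xi> * ?Y \<omega>))"
    by (rule indep_set_indep_var[OF increment_indep[OF s] subalg[OF s(1)] Z Y, of "\<lambda>y. iexp (\<xi> * y)"]) measurable
  have "(CLINT \<omega>|M. Z \<omega> * iexp (\<xi> * ?Y \<omega>)) = (CLINT \<omega>|M. Z \<omega>) * (CLINT \<omega>|M. iexp (\<xi> * ?Y \<omega>))"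
  proof (rule indep_var_lebesgue_integral[OF iv])
    show "integrable M Z" by (rule integrable_const_bound[where B = B]) (use ZB in auto)
    have "(\<lambda>\<omega>. iexp (\<xi> * ?Y \<omega>)) \<in> borel_measurable M" by measurable
    then show "integrable M (\<lambda>\<omega>. iexp (\<xi> * ?Y \<omega>))"
      by (rule integrable_const_bound[where B = 1, rotated]) (simp del: of_real_mult of_real_diff)
  qed
  also have "(CLINT \<omega>|M. iexp (\<xi> * ?Y \<omega>)) = complex_of_real (exp (- (\<xi>\<^sup>2 * (t - s)) / 2))"
    using integral_iexp_normal[OF _ increment_normal[OF s], of \<xi>] s by simp
  finally show ?thesis .
qed

text \<open>The increments are split off from the last one backwards: all earlier exponentials are
  measurable at time \<open>p n\<close> and are absorbed into the weight, which keeps the bound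
  \<open>B\<close>.\<close>

lemma integral_iexp_weighted_increments:
  fixes p :: "nat \<Rightarrow> real" and e :: "nat \<Rightarrow> real"
  assumes p: "0 \<le> p 0" "\<And>i. i < n \<Longrightarrow> p i < p (Suc i)"
    and Z: "Z \<in> borel_measurable (F (p 0))" and ZB: "\<And>\<omega>. norm (Z \<omega>) \<le> B"
  shows "(CLINT \<omega>|M. Z \<omega> * iexp (\<xi> * (\<Sum>i<n. e i * (W (p (Suc i)) \<omega> - W (p i) \<omega>))))
    = (CLINT \<omega>|M. Z \<omega>) * complex_of_real (exp (- (\<xi>\<^sup>2 * (\<Sum>i<n. (e i)\<^sup>2 * (p (Suc i) - p i))) / 2))"
  using p(2)
proof (induction n)
  case (Suc n)
  have mono: "p i \<le> p j" if "i \<le> j" "j \<le> Suc n" for i j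
    using that
  proof (induction j rule: dec_induct)
    case (step k)
    then show ?case using Suc.prems[of k] by simp
  qed simp
  have pn: "0 \<le> p i" if "i \<le> Suc n" for i using p(1) mono[of 0 i] that by simp
  let ?S = "\<lambda>\<omega>. \<Sum>i<n. e i * (W (p (Suc i)) \<omega> - W (p i) \<omega>)"
  let ?Z = "\<lambda>\<omega>. Z \<omega> * iexp (\<xi> * ?S \<omega>)"
  have Wm: "W (p i) \<in> borel_measurable (F (p n))" if "i \<le> n" for i
    using that pn mono by (intro filt_measurable[OF _ _ adapted]) auto
  have Sm[measurable]: "?S \<in> borel_measurable (F (p n))"
    using Wm by (intro borel_measurable_sum borel_measurable_times borel_measurable_diff) auto
  have Zm[measurable]: "Z \<in> borel_measurable (F (p n))"
    using mono p by (intro filt_measurable[OF _ _ Z]) auto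
  have "(CLINT \<omega>|M. Z \<omega> * iexp (\<xi> * (\<Sum>i<Suc n. e i * (W (p (Suc i)) \<omega> - W (p i) \<omega>))))
    = (CLINT \<omega>|M. ?Z \<omega> * iexp ((\<xi> * e n) * (W (p (Suc n)) \<omega> - W (p n) \<omega>)))"
    by (intro Bochner_Integration.integral_cong) (auto simp: distrib_left exp_add[symmetric] mult.assoc)
  also have "\<dots> = (CLINT \<omega>|M. ?Z \<omega>) * complex_of_real (exp (- ((\<xi> * e n)\<^sup>2 * (p (Suc n) - p n)) / 2))"
  proof (rule integral_iexp_increment[where B = B])
    show "?Z \<in> borel_measurable (F (p n))" by measurable
    show "norm (?Z \<omega>) \<le> B" for \<omega>
      using ZB by (simp add: norm_mult del: of_real_sum of_real_mult of_real_diff)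
  qed (use Suc.prems pn in auto)
  also have "(CLINT \<omega>|M. ?Z \<omega>) = (CLINT \<omega>|M. Z \<omega>) * complex_of_real (exp (- (\<xi>\<^sup>2 * (\<Sum>i<n. (e i)\<^sup>2 * (p (Suc i) - p i))) / 2))"
    using Suc by simp
  also have "\<dots> * complex_of_real (exp (- ((\<xi> * e n)\<^sup>2 * (p (Suc n) - p n)) / 2))
    = (CLINT \<omega>|M. Z \<omega>) * complex_of_real (exp (- (\<xi>\<^sup>2 * (\<Sum>i<Suc n. (e i)\<^sup>2 * (p (Suc i) - p i))) / 2))"
    by (simp add: mult.assoc of_real_mult[symmetric] exp_add[symmetric] power_mult_distrib distrib_left add_divide_distrib del: of_real_mult)
  finally show ?case .
qed simp

text \<open>The Wiener integral of \<open>g\<close> seen through characteristic functions: the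
  exponentials are bounded, so dominated convergence applies, and the variances are Riemann sums of
  the square of \<open>g\<close>. The weight \<open>Z\<close> preserves the independence from
  \<open>F r\<close>.\<close>

lemma integral_iexp_limit:
  assumes r: "0 \<le> r" "r < s" and g: "continuous_on {r..s} g"
    and Z: "Z \<in> borel_measurable (F r)" and ZB: "\<And>\<omega>. norm (Z \<omega>) \<le> B"
    and Y[measurable]: "Y \<in> borel_measurable M"
    and lim: "AE \<omega> in M. (\<lambda>n. \<Sum>i<n. g (grid r s n i) * (W (grid r s n (Suc i)) \<omega> - W (grid r s n i) \<omega>)) \<longlonglongrightarrow> Y \<omega>"
  shows "(CLINT \<omega>|M. Z \<omega> * iexp (\<xi> * Y \<omega>))
    = (CLINT \<omega>|M. Z \<omega>) * complex_of_real (exp (- (\<xi>\<^sup>2 * integral {r..s} (\<lambda>u. (g u)\<^sup>2)) / 2))"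
proof (rule LIMSEQ_unique)
  let ?p = "grid r s"
  let ?S = "\<lambda>n \<omega>. \<Sum>i<n. g (?p n i) * (W (?p n (Suc i)) \<omega> - W (?p n i) \<omega>)"
  let ?v = "\<lambda>n. \<Sum>i<n. (g (?p n i))\<^sup>2 * (?p n (Suc i) - ?p n i)"
  have ZM[measurable]: "Z \<in> borel_measurable M" using measurable_from_subalg[OF subalg[OF r(1)] Z] .
  have pn: "0 \<le> ?p n i" for n i using r by (simp add: grid_def)
  have Sm[measurable]: "?S n \<in> borel_measurable M" for n
    using pn by (intro borel_measurable_sum borel_measurable_times increment_measurable) auto
  have B0: "0 \<le> B" using ZB[of undefined] norm_ge_zero order_trans by blast
  show "(\<lambda>n. CLINT \<omega>|M. Z \<omega> * iexp (\<xi> * ?S n \<omega>)) \<longlonglongrightarrow> (CLINT \<omega>|M. Z \<omega> * iexp (\<xi> * Y \<omega>))"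
  proof (rule integral_dominated_convergence[where w = "\<lambda>_. B"])
    show "AE \<omega> in M. (\<lambda>n. Z \<omega> * iexp (\<xi> * ?S n \<omega>)) \<longlonglongrightarrow> Z \<omega> * iexp (\<xi> * Y \<omega>)"
      using lim by eventually_elim (intro tendsto_intros)
    show "(\<lambda>\<omega>. Z \<omega> * iexp (\<xi> * ?S n \<omega>)) \<in> borel_measurable M" for n
      using Sm[of n] by measurable
    show "(\<lambda>\<omega>. Z \<omega> * iexp (\<xi> * Y \<omega>)) \<in> borel_measurable M" by measurable
    show "AE \<omega> in M. norm (Z \<omega> * iexp (\<xi> * ?S n \<omega>)) \<le> B" for n
      using ZB by (intro AE_I2) (simp add: norm_mult del: of_real_sum of_real_mult of_real_diff)
  qed simp
  have eq: "(CLINT \<omega>|M. Z \<omega> * iexp (\<xi> * ?S n \<omega>)) = (CLINT \<omega>|M. Z \<omega>) * complex_of_real (exp (- (\<xi>\<^sup>2 * ?v n) / 2))" for n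
  proof (rule integral_iexp_weighted_increments[OF _ _ _ ZB])
    show "?p n i < ?p n (Suc i)" if "i < n" for i
    proof -
      have "0 < (s - r) / real n" using that r by (intro divide_pos_pos) auto
      then show ?thesis using grid_props(4)[of r s i n] that r by linarith
    qed
  qed (use r Z in \<open>auto simp: grid_def\<close>)
  have "?v \<longlonglongrightarrow> integral {r..s} (\<lambda>u. (g u)\<^sup>2)"
    using r g by (intro Riemann_sum_tendsto_integral continuous_intros) auto
  then show "(\<lambda>n. CLINT \<omega>|M. Z \<omega> * iexp (\<xi> * ?S n \<omega>)) \<longlonglongrightarrow>
    (CLINT \<omega>|M. Z \<omega>) * complex_of_real (exp (- (\<xi>\<^sup>2 * integral {r..s} (\<lambda>u. (g u)\<^sup>2)) / 2))"
    unfolding eq by (intro tendsto_intros) auto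
qed

end

section \<open>Hoelder continuity of the local time\<close>

lemma integrable_square_diff:
  fixes f g :: "'b \<Rightarrow> real"
  assumes [measurable]: "f \<in> borel_measurable M" "g \<in> borel_measurable M"
    and "integrable M (\<lambda>\<omega>. (f \<omega>)\<^sup>2)" "integrable M (\<lambda>\<omega>. (g \<omega>)\<^sup>2)"
  shows "integrable M (\<lambda>\<omega>. (f \<omega> - g \<omega>)\<^sup>2)"
proof (rule Bochner_Integration.integrable_bound)
  show "integrable M (\<lambda>\<omega>. 2 * (f \<omega>)\<^sup>2 + 2 * (g \<omega>)\<^sup>2)" using assms by simp
  show "AE \<omega> in M. norm ((f \<omega> - g \<omega>)\<^sup>2) \<le> norm (2 * (f \<omega>)\<^sup>2 + 2 * (g \<omega>)\<^sup>2)"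
  proof (intro AE_I2)
    fix \<omega>
    have "0 \<le> (f \<omega> + g \<omega>)\<^sup>2" by simp
    then have "(f \<omega> - g \<omega>)\<^sup>2 \<le> 2 * (f \<omega>)\<^sup>2 + 2 * (g \<omega>)\<^sup>2"
      by (simp add: power2_sum power2_diff)
    then show "norm ((f \<omega> - g \<omega>)\<^sup>2) \<le> norm (2 * (f \<omega>)\<^sup>2 + 2 * (g \<omega>)\<^sup>2)" by simp
  qed
qed measurable

text \<open>Both limits must be taken along one sequence. The sum of the two squared errors tends to
  0 in L1, and a subsequence along which the sum converges almost surely serves both terms.\<close>

lemma tendsto_L2_AE_subseq_pair:
  assumes f: "tendsto_L2 M f g (at_right (0::real))" and f': "tendsto_L2 M f' g' (at_right 0)"
  obtains e :: "nat \<Rightarrow> real" where "\<And>n. 0 < e n"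
    "\<And>n. f (e n) \<in> borel_measurable M" "\<And>n. f' (e n) \<in> borel_measurable M"
    "AE \<omega> in M. (\<lambda>n. f (e n) \<omega>) \<longlonglongrightarrow> g \<omega> \<and> (\<lambda>n. f' (e n) \<omega>) \<longlonglongrightarrow> g' \<omega>"
proof -
  have "\<forall>\<^sub>F i in at_right 0. (f i \<in> borel_measurable M \<and> integrable M (\<lambda>\<omega>. (f i \<omega>)\<^sup>2)) \<and>
      (f' i \<in> borel_measurable M \<and> integrable M (\<lambda>\<omega>. (f' i \<omega>)\<^sup>2))"
    using f f' unfolding tendsto_L2_def eventually_conj_iff by blast
  then obtain \<delta> where \<delta>: "0 < \<delta>" "\<And>i. 0 < i \<Longrightarrow> i < \<delta> \<Longrightarrow>
      f i \<in> borel_measurable M \<and> integrable M (\<lambda>\<omega>. (f i \<omega>)\<^sup>2) \<and> f' i \<in> borel_measurable M \<and> integrable M (\<lambda>\<omega>. (f' i \<omega>)\<^sup>2)"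
    unfolding eventually_at_right_field by auto
  \<comment> \<open>\<open>n + 2\<close> keeps \<open>e n\<close> strictly below
    \<open>\<delta>\<close> already for n = 0, so the eventual properties hold along the whole
    sequence.\<close>
  define e where "e n = \<delta> / real (n + 2)" for n
  have e: "0 < e n" "e n < \<delta>" for n using \<delta>(1) by (auto simp: e_def field_simps add_pos_nonneg)
  have "e \<longlonglongrightarrow> 0"
    unfolding e_def using LIMSEQ_ignore_initial_segment[OF lim_const_over_n[of \<delta>], of 2] by simp
  then have lim: "filterlim e (at_right 0) sequentially"
    using e by (intro tendsto_imp_filterlim_at_right) auto
  have g[measurable]: "g \<in> borel_measurable M" "g' \<in> borel_measurable M"
    and g2: "integrable M (\<lambda>\<omega>. (g \<omega>)\<^sup>2)" "integrable M (\<lambda>\<omega>. (g' \<omega>)\<^sup>2)"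
    using f f' by (auto simp: tendsto_L2_def)
  define u where "u n \<omega> = (f (e n) \<omega> - g \<omega>)\<^sup>2 + (f' (e n) \<omega> - g' \<omega>)\<^sup>2" for n \<omega>
  have i: "integrable M (\<lambda>\<omega>. (f (e n) \<omega> - g \<omega>)\<^sup>2)" "integrable M (\<lambda>\<omega>. (f' (e n) \<omega> - g' \<omega>)\<^sup>2)" for n
    using \<delta>(2)[OF e, of n] g g2 by (auto intro!: integrable_square_diff)
  have "(\<lambda>n. LINT \<omega>|M. (f (e n) \<omega> - g \<omega>)\<^sup>2) \<longlonglongrightarrow> 0" "(\<lambda>n. LINT \<omega>|M. (f' (e n) \<omega> - g' \<omega>)\<^sup>2) \<longlonglongrightarrow> 0"
    using f f' filterlim_compose[OF _ lim] unfolding tendsto_L2_def by fast+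
  from tendsto_add[OF this] have "(\<lambda>n. LINT \<omega>|M. norm (u n \<omega>)) \<longlonglongrightarrow> 0"
    using i by (simp add: u_def)
  moreover have "integrable M (u n)" for n unfolding u_def using i by simp
  ultimately obtain k :: "nat \<Rightarrow> nat" where k: "AE \<omega> in M. (\<lambda>n. u (k n) \<omega>) \<longlonglongrightarrow> 0"
    using tendsto_L1_AE_subseq[of M u] by blast
  show ?thesis
  proof (rule that[of "\<lambda>n. e (k n)"])
    show "AE \<omega> in M. (\<lambda>n. f (e (k n)) \<omega>) \<longlonglongrightarrow> g \<omega> \<and> (\<lambda>n. f' (e (k n)) \<omega>) \<longlonglongrightarrow> g' \<omega>"
      using k
    proof eventually_elim
      case (elim \<omega>)
      have *: "a \<longlonglongrightarrow> l" if le: "\<And>n. (a n - l)\<^sup>2 \<le> u (k n) \<omega>" for a and l :: real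
      proof -
        have "(\<lambda>n. (a n - l)\<^sup>2) \<longlonglongrightarrow> 0"
          by (rule tendsto_sandwich[OF _ _ tendsto_const elim]) (use le in auto)
        from tendsto_real_sqrt[OF this] have "(\<lambda>n. a n - l) \<longlonglongrightarrow> 0"
          by (simp add: tendsto_rabs_zero_iff)
        then show ?thesis by (simp add: LIM_zero_iff)
      qed
      show ?case by (intro conjI *) (auto simp: u_def)
    qed
  qed (use e \<delta>(2) in auto)
qed

context std_brownian_motion
begin

text \<open>\<open>m\<close> and \<open>v\<close> are read off the explicit formula: X_s is m X_r
  plus the integral of exp (-(A_s - A_u)) dW_u over [r, s], whose variance is exp (-2 A_s) (Q_s -
  Q_r).\<close>

lemma solves_OU_gaussian_markov:
  fixes \<alpha> :: "real \<Rightarrow> real" and X :: "real \<Rightarrow> 'a \<Rightarrow> real"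
  assumes \<alpha>_pos: "\<And>s. 0 \<le> s \<Longrightarrow> 0 < \<alpha> s"
    and \<alpha>_int: "\<And>T. 0 \<le> T \<Longrightarrow> set_integrable lebesgue {0..T} \<alpha>"
    and OU: "solves_OU M F \<alpha> W X" and t: "0 < t"
  obtains v m c X' where "gaussian_markov v m t c M F X'" "AE \<omega> in M. \<forall>s\<ge>0. X' s \<omega> = X s \<omega>"
proof -
  define A where "A u = integral {0..u} \<alpha>" for u
  define Q where "Q u = integral {0..u} (\<lambda>u. exp (2 * A u))" for u
  define v where "v r s = exp (- 2 * A s) * (Q s - Q r)" for r s
  define m where "m r s = exp (- (A s - A r))" for r s
  define c where "c = exp (- 2 * A t)"
  have \<alpha>i: "\<alpha> integrable_on {0..T}" for T
    using set_lebesgue_integral_eq_integral(1)[OF \<alpha>_int] by (cases "0 \<le> T") auto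
  have Ac: "continuous_on {0..T} A" for T
    unfolding A_def by (rule indefinite_integral_continuous_1[OF \<alpha>i])
  have Qi: "(\<lambda>u. exp (2 * A u)) integrable_on {0..T}" for T
    by (intro integrable_continuous_interval continuous_intros Ac)
  have Amono: "A a \<le> A b" if "a \<le> b" for a b
    unfolding A_def using that \<alpha>_pos by (intro integral_subset_le \<alpha>i) (auto intro: less_imp_le)
  have Qmono: "Q a \<le> Q b" if "a \<le> b" for a b
    unfolding Q_def using that by (intro integral_subset_le Qi) auto
  have A0: "0 \<le> A u" for u
    unfolding A_def using \<alpha>_pos by (intro integral_nonneg \<alpha>i) (auto intro: less_imp_le)
  \<comment> \<open>At negative times the integrals run over an empty interval and vanish, so
    \<open>A\<close> and \<open>Q\<close> are monotone on the whole line and hence Borel.\<close>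
  have [measurable]: "A \<in> borel_measurable borel" "Q \<in> borel_measurable borel"
    using Amono Qmono by (auto intro!: borel_measurable_mono simp: mono_def)
  have Qdiff: "Q s - Q r = integral {r..s} (\<lambda>u. exp (2 * A u))" if "0 \<le> r" "r \<le> s" for r s
    unfolding Q_def using Henstock_Kurzweil_Integration.integral_combine[OF that Qi] by simp
  have vpos: "exp (- 2 * A s) * (s - r) \<le> v r s" if "0 \<le> r" "r \<le> s" for r s
  proof -
    have "s - r = integral {r..s} (\<lambda>u. 1)" using that by simp
    also have "\<dots> \<le> integral {r..s} (\<lambda>u. exp (2 * A u))"
      using A0 integrable_on_subinterval[OF Qi, of r s s] that by (intro integral_le) auto
    finally show ?thesis unfolding v_def Qdiff[OF that] by simp
  qed
  interpret G: gaussian_kernel v m t c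
  proof
    show "case_prod v \<in> borel_measurable (borel \<Otimes>\<^sub>M borel)" unfolding v_def split_beta' by measurable
    show "case_prod m \<in> borel_measurable (borel \<Otimes>\<^sub>M borel)" unfolding m_def split_beta' by measurable
    fix r s :: real assume rs: "0 \<le> r" "r < s" "s \<le> t"
    show "\<bar>m r s\<bar> \<le> 1" using Amono[of r s] rs by (simp add: m_def)
    have "c * (s - r) \<le> exp (- 2 * A s) * (s - r)"
      unfolding c_def using Amono[OF rs(3)] rs by (intro mult_right_mono) auto
    also have "\<dots> \<le> v r s" using vpos rs by simp
    finally show "c * (s - r) \<le> v r s" .
  qed (auto simp: t c_def)
  have Xad: "\<And>s. 0 \<le> s \<Longrightarrow> X s \<in> borel_measurable (F s)"
    and Xae: "AE \<omega> in M. continuous_on {0..} (\<lambda>t. X t \<omega>) \<and>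
      (\<forall>t\<ge>0. X t \<omega> = - (LINT s:{0..t}|lebesgue. \<alpha> s * X s \<omega>) + W t \<omega>)"
    using OU unfolding solves_OU_def by auto
  obtain N where N: "{\<omega> \<in> space M. \<not> (continuous_on {0..} (\<lambda>t. X t \<omega>) \<and>
      (\<forall>t\<ge>0. X t \<omega> = - (LINT s:{0..t}|lebesgue. \<alpha> s * X s \<omega>) + W t \<omega>))} \<subseteq> N" "N \<in> null_sets M"
    using Xae by (rule AE_E) auto
  \<comment> \<open>Paths in \<open>N\<close>, which contains all those violating continuity or the
    equation, are set to 0. As \<open>N\<close> is null it lies in \<open>F 0\<close>, so
    adaptedness survives.\<close>
  define X' where "X' s \<omega> = (if \<omega> \<in> N then 0 else X s \<omega>)" for s \<omega>
  have NF: "N \<in> sets (F s)" if "0 \<le> s" for s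
    using N(2) null_sets_F0 filt_mono[of 0 s] that by auto
  have X'ad: "X' s \<in> borel_measurable (F s)" if "0 \<le> s" for s
    unfolding X'_def using Xad[OF that] NF[OF that] by measurable
  have X'c: "continuous_on {0..} (\<lambda>s. X' s \<omega>)" if "\<omega> \<in> space M" for \<omega>
    using N(1) that by (cases "\<omega> \<in> N") (auto simp: X'_def)
  have notN: "AE \<omega> in M. \<omega> \<notin> N" using N(2) by (rule AE_not_in)
  \<comment> \<open>A continuous path is bounded on [0, T] and \<alpha> is integrable there.
    Absolute integrability identifies the Lebesgue drift integral with the gauge integral used for
    the weighted sums.\<close>
  have drift: "(\<lambda>u. \<alpha> u * X u \<omega>) absolutely_integrable_on {0..T}" if "\<omega> \<in> space M" "\<omega> \<notin> N" "0 \<le> T" for \<omega> T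
  proof -
    have c: "continuous_on {0..T} (\<lambda>u. X u \<omega>)"
      using N(1) that by (intro continuous_on_subset[where s = "{0..}" and t = "{0..T}"]) auto
    have "(\<lambda>u. X u \<omega> * \<alpha> u) absolutely_integrable_on {0..T}"
    proof (rule absolutely_integrable_bounded_measurable_product_real)
      show "bounded ((\<lambda>u. X u \<omega>) ` {0..T})" using c by (intro compact_imp_bounded compact_continuous_image) auto
      show "(\<lambda>u. X u \<omega>) \<in> borel_measurable (lebesgue_on {0..T})"
        using c by (intro continuous_imp_measurable_on_sets_lebesgue) auto
    qed (use \<alpha>_int that in auto)
    then show ?thesis by (simp add: mult.commute)
  qed
  have "gaussian_markov v m t c M F X'"
  proof
    fix r s B K :: real and Z :: "'a \<Rightarrow> real" and \<phi> :: "real \<Rightarrow> real"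
    assume rs: "0 \<le> r" "r < s" "s \<le> t" and Z: "Z \<in> borel_measurable (F r)" and ZB: "\<And>\<omega>. \<bar>Z \<omega>\<bar> \<le> B"
      and \<phi>: "\<phi> \<in> borel_measurable borel" and K: "\<And>w. \<bar>\<phi> w\<bar> \<le> K"
    \<comment> \<open>The new noise between \<open>r\<close> and \<open>s\<close>, identified below
      as the limit of weighted Brownian increments.\<close>
    define Y where "Y \<omega> = X' s \<omega> - m r s * X' r \<omega>" for \<omega>
    have X'M[measurable]: "X' s \<in> borel_measurable M" "X' r \<in> borel_measurable M"
      using measurable_from_subalg[OF subalg X'ad] rs by auto
    have Y[measurable]: "Y \<in> borel_measurable M" unfolding Y_def by measurable
    have vp: "0 < v r s" using G.v_pos[OF rs] .
    let ?g = "\<lambda>u. exp (- (A s - A u))"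
    have gc: "continuous_on {r..s} ?g"
      using rs by (intro continuous_intros continuous_on_subset[OF Ac[of s]]) auto
    have "AE \<omega> in M. (\<lambda>n. \<Sum>i<n. ?g (grid r s n i) * (W (grid r s n (Suc i)) \<omega> - W (grid r s n i) \<omega>)) \<longlonglongrightarrow> Y \<omega>"
      using notN AE_space
    proof eventually_elim
      case (elim \<omega>)
      have Xc: "continuous_on {0..s} (\<lambda>u. X u \<omega>)"
        using N(1) elim by (intro continuous_on_subset[where s = "{0..}" and t = "{0..s}"]) auto
      have Xeq: "X u \<omega> = - integral {0..u} (\<lambda>u. \<alpha> u * X u \<omega>) + W u \<omega>" if "0 \<le> u" for u
      proof -
        have "X u \<omega> = - (LINT s:{0..u}|lebesgue. \<alpha> s * X s \<omega>) + W u \<omega>" using N(1) elim that by blast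
        then show ?thesis
          using set_lebesgue_integral_eq_integral(2)[OF drift[OF elim(2,1) that]] by simp
      qed
      have "(\<lambda>n. \<Sum>i<n. ?g (grid r s n i) * (W (grid r s n (Suc i)) \<omega> - W (grid r s n i) \<omega>))
        \<longlonglongrightarrow> X s \<omega> - ?g r * X r \<omega>"
        unfolding A_def
      proof (rule linear_drift_weighted_sums)
        show "(\<lambda>u. \<alpha> u * X u \<omega>) integrable_on {0..s}"
          using drift[OF elim(2,1)] rs by (intro set_lebesgue_integral_eq_integral(1)) auto
      qed (use rs \<alpha>i Xc Xeq \<alpha>_pos in \<open>auto intro: less_imp_le\<close>)
      then show ?case using elim by (simp add: Y_def X'_def m_def)
    qed
    note lim = integral_iexp_limit[OF rs(1,2) gc _ _ Y this]
    have vint: "integral {r..s} (\<lambda>u. (?g u)\<^sup>2) = v r s"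
    proof -
      have "(?g u)\<^sup>2 = exp (- 2 * A s) * exp (2 * A u)" for u
        by (simp add: power2_eq_square exp_add[symmetric])
      then show ?thesis using rs by (simp add: v_def Qdiff)
    qed
    \<comment> \<open>With indicators of events of \<open>F r\<close> as weights, the limit formula
      becomes a conditional characteristic function.\<close>
    have ch: "(CLINT \<omega>|M. indicator B \<omega> * iexp (\<xi> * Y \<omega>)) = complex_of_real (prob B * exp (- (\<xi>\<^sup>2 * (sqrt (v r s))\<^sup>2) / 2))"
      if B: "B \<in> sets (F r)" for B \<xi>
    proof -
      have BM: "B \<in> sets M" using B subalg[OF rs(1)] by (auto simp: subalgebra_def)
      have "(CLINT \<omega>|M. indicator B \<omega> * iexp (\<xi> * Y \<omega>))
        = (CLINT \<omega>|M. indicator B \<omega>) * complex_of_real (exp (- (\<xi>\<^sup>2 * v r s) / 2))"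
        using lim[of "indicator B" 1 \<xi>] B unfolding vint by (simp add: indicator_def)
      also have "(CLINT \<omega>|M. indicator B \<omega>) = complex_of_real (prob B)"
      proof -
        have "(CLINT \<omega>|M. indicator B \<omega>) = (CLINT \<omega>|M. complex_of_real (indicator B \<omega>))"
          by (intro Bochner_Integration.integral_cong) (auto simp: indicator_def)
        also have "\<dots> = complex_of_real (prob B)"
          unfolding integral_complex_of_real using sets.sets_into_space[OF BM] by (simp add: Int_absorb2)
        finally show ?thesis .
      qed
      finally show ?thesis using vp by simp
    qed
    note nrm = normal_indep_of_char[OF subalg[OF rs(1)] Y _ ch]
    have sp: "0 < sqrt (v r s)" using vp by simp
    have "(LINT \<omega>|M. Z \<omega> * \<phi> (m r s * X' r \<omega> + Y \<omega>))
      = (LINT \<omega>|M. Z \<omega> * (LINT w|lborel. heat_kernel (v r s) (w - m r s * X' r \<omega>) * \<phi> w))"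
      by (rule integral_indep_normal[OF nrm(1)[OF sp] nrm(2)[OF sp] vp subalg[OF rs(1)] Z _ ZB \<phi> K])
        (assumption | intro borel_measurable_times borel_measurable_const X'ad[OF rs(1)])+
    then show "(LINT \<omega>|M. Z \<omega> * \<phi> (X' s \<omega>)) = (LINT \<omega>|M. Z \<omega> * G.transition r s \<phi> (X' r \<omega>))"
      by (simp add: Y_def G.transition_def G.q_def)
  qed (use subalg filt_mono X'ad X'c in auto)
  moreover have "AE \<omega> in M. \<forall>s\<ge>0. X' s \<omega> = X s \<omega>"
    using notN by eventually_elim (simp add: X'_def)
  ultimately show ?thesis by (rule that)
qed

end

text \<open>The moment bound of the mollified increments is free of \<epsilon> and therefore
  survives the limit. \<open>X\<close> is the version with all paths continuous, \<open>X0\<close>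
  the process whose local time is given.\<close>

lemma (in gaussian_markov) local_time_moment:
  assumes lt: "is_local_time M X0 L" and X0: "AE \<omega> in M. \<forall>s\<ge>0. X s \<omega> = X0 s \<omega>"
    and \<theta>: "0 < \<theta>" "\<theta> < 1"
  shows "(\<integral>\<^sup>+\<omega>. ennreal (\<bar>L t x \<omega> - L t y \<omega>\<bar> ^ (2 * k)) \<partial>M)
    \<le> ennreal (fact (2 * k) * pconst \<theta> ^ (2 * k) * (\<bar>x - y\<bar> powr \<theta>) ^ k)"
proof -
  let ?a = "\<lambda>z \<epsilon> \<omega>. LINT r:{0..t}|lborel. heat_kernel \<epsilon> (X0 r \<omega> - z)"
  have "tendsto_L2 M (?a z) (L t z) (at_right 0)" for z
    using lt t_pos unfolding is_local_time_def by auto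
  from tendsto_L2_AE_subseq_pair[OF this[of x] this[of y]]
  obtain e :: "nat \<Rightarrow> real" where e: "\<And>n. 0 < e n"
    and em[measurable]: "\<And>n. ?a x (e n) \<in> borel_measurable M" "\<And>n. ?a y (e n) \<in> borel_measurable M"
    and ec: "AE \<omega> in M. (\<lambda>n. ?a x (e n) \<omega>) \<longlonglongrightarrow> L t x \<omega> \<and> (\<lambda>n. ?a y (e n) \<omega>) \<longlonglongrightarrow> L t y \<omega>"
    by blast
  let ?d = "\<lambda>n \<omega>. ?a x (e n) \<omega> - ?a y (e n) \<omega>"
  let ?D = "fact (2 * k) * pconst \<theta> ^ (2 * k) * (\<bar>x - y\<bar> powr \<theta>) ^ k"
  have d: "AE \<omega> in M. ?d n \<omega> = (LINT s|lborel. indicator {0..t} s * heat_diff (e n) x y (X (max 0 s) \<omega>))" for n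
    using X0 AE_space
  proof eventually_elim
    case (elim \<omega>)
    have "continuous_on {0..t} (\<lambda>s. X s \<omega>)" using cont[OF elim(2)] by (rule continuous_on_subset) auto
    then have c0: "continuous_on {0..t} (\<lambda>s. X0 s \<omega>)"
      using elim(1) by (subst (asm) continuous_on_cong[OF refl, of _ _ "\<lambda>s. X0 s \<omega>"]) auto
    have "set_integrable lborel {0..t} (\<lambda>s. heat_kernel (e n) (X0 s \<omega> - z))" for z
      by (intro borel_integrable_atLeastAtMost' continuous_intros c0 e)
    then have "?d n \<omega> = (LINT s:{0..t}|lborel. heat_kernel (e n) (X0 s \<omega> - x) - heat_kernel (e n) (X0 s \<omega> - y))"
      by simp
    also have "\<dots> = (LINT s|lborel. indicator {0..t} s * heat_diff (e n) x y (X (max 0 s) \<omega>))"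
      unfolding set_lebesgue_integral_def using elim(1)
      by (intro Bochner_Integration.integral_cong) (auto simp: heat_diff_def indicator_def)
    finally show ?case .
  qed
  have "(\<integral>\<^sup>+\<omega>. ennreal (\<bar>L t x \<omega> - L t y \<omega>\<bar> ^ (2 * k)) \<partial>M) = (\<integral>\<^sup>+\<omega>. liminf (\<lambda>n. ennreal (\<bar>?d n \<omega>\<bar> ^ (2 * k))) \<partial>M)"
  proof (rule nn_integral_cong_AE)
    show "AE \<omega> in M. ennreal (\<bar>L t x \<omega> - L t y \<omega>\<bar> ^ (2 * k)) = liminf (\<lambda>n. ennreal (\<bar>?d n \<omega>\<bar> ^ (2 * k)))"
      using ec
    proof eventually_elim
      case (elim \<omega>)
      then have "(\<lambda>n. ennreal (\<bar>?d n \<omega>\<bar> ^ (2 * k))) \<longlonglongrightarrow> ennreal (\<bar>L t x \<omega> - L t y \<omega>\<bar> ^ (2 * k))"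
        by (intro tendsto_intros) auto
      from lim_imp_Liminf[OF _ this] show ?case by simp
    qed
  qed
  also have "\<dots> \<le> liminf (\<lambda>n. \<integral>\<^sup>+\<omega>. ennreal (\<bar>?d n \<omega>\<bar> ^ (2 * k)) \<partial>M)"
    by (intro nn_integral_liminf) measurable
  also have "\<dots> \<le> liminf (\<lambda>n. ennreal ?D)"
  proof (intro Liminf_mono always_eventually allI)
    fix n
    have "(\<integral>\<^sup>+\<omega>. ennreal (\<bar>?d n \<omega>\<bar> ^ (2 * k)) \<partial>M)
      = (\<integral>\<^sup>+\<omega>. ennreal ((LINT s|lborel. indicator {0..t} s * heat_diff (e n) x y (X (max 0 s) \<omega>)) ^ (2 * k)) \<partial>M)"
    proof (rule nn_integral_cong_AE)
      show "AE \<omega> in M. ennreal (\<bar>?d n \<omega>\<bar> ^ (2 * k))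
        = ennreal ((LINT s|lborel. indicator {0..t} s * heat_diff (e n) x y (X (max 0 s) \<omega>)) ^ (2 * k))"
        using d[of n] by eventually_elim (simp add: power_even_abs)
    qed
    also have "\<dots> \<le> ennreal ?D" by (rule local_time_increment_moment[OF e \<theta>])
    finally show "(\<integral>\<^sup>+\<omega>. ennreal (\<bar>?d n \<omega>\<bar> ^ (2 * k)) \<partial>M) \<le> ennreal ?D" .
  qed
  also have "\<dots> = ennreal ?D" by (rule Liminf_const) simp
  finally show ?thesis .
qed

theorem theorem4p2:
  fixes M :: "'a measure" and F :: "real \<Rightarrow> 'a measure"
    and W X :: "real \<Rightarrow> 'a \<Rightarrow> real"
    and \<alpha> :: "real \<Rightarrow> real"
    and L :: "real \<Rightarrow> real \<Rightarrow> 'a \<Rightarrow> real"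
    and R t :: real
  assumes "std_brownian_motion M F W"
    and "\<And>s. 0 \<le> s \<Longrightarrow> 0 < \<alpha> s"
    and "set_borel_measurable lebesgue {0..} \<alpha>"
    and "\<And>T. 0 \<le> T \<Longrightarrow> set_integrable lebesgue {0..T} \<alpha>"
    and "solves_OU M F \<alpha> W X"
    and "is_local_time M X L"
    and "0 < R" and "0 < t"
  shows "\<exists>L' :: real \<Rightarrow> 'a \<Rightarrow> real. is_modification M (L t) L' \<and>
           (\<forall>l. 0 < l \<and> l < 1/2 \<longrightarrow>
              (\<exists>C :: 'a \<Rightarrow> real. C \<in> borel_measurable M \<and> (AE \<omega> in M. 0 < C \<omega>) \<and>
                 (AE \<omega> in M. \<forall>x\<in>{-R..R}. \<forall>y\<in>{-R..R}.
                    \<bar>L' x \<omega> - L' y \<omega>\<bar> \<le> C \<omega> * \<bar>x - y\<bar> powr l)))"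
proof -
  interpret std_brownian_motion M F W by fact
  obtain v m c X' where gm: "gaussian_markov v m t c M F X'" and X': "AE \<omega> in M. \<forall>s\<ge>0. X' s \<omega> = X s \<omega>"
    by (rule solves_OU_gaussian_markov[OF assms(2,4,5,8)])
  interpret G: gaussian_markov v m t c M F X' by fact
  have Lm: "L t x \<in> borel_measurable M" for x
    using assms(6,8) unfolding is_local_time_def tendsto_L2_def by auto
  \<comment> \<open>An affine parametrisation of [-R, R] by the unit interval, on which the
    continuity criterion is stated.\<close>
  define V where "V z = L t (2 * R * z - R)" for z
  have Vm: "V z \<in> borel_measurable M" for z unfolding V_def by (rule Lm)
  have kc: "(\<exists>C. C \<in> borel_measurable M \<and> (\<forall>\<omega>. 0 < C \<omega>) \<and>
      (AE \<omega> in M. \<forall>x\<in>{0..1}. \<forall>y\<in>{0..1}.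
        \<bar>dyadic_limit (\<lambda>z. V z \<omega>) x - dyadic_limit (\<lambda>z. V z \<omega>) y\<bar> \<le> C \<omega> * \<bar>x - y\<bar> powr l)) \<and>
     (\<forall>x\<in>{0..1}. AE \<omega> in M. dyadic_limit (\<lambda>z. V z \<omega>) x = V x \<omega>)"
    if l: "0 < l" "l < 1/2" for l
  proof -
    \<comment> \<open>The midpoint of 2 l and 1, so that \<theta> - 2 l = 1/2 - l > 0. Then k is
      chosen with k (1/2 - l) > 1, which is the criterion's condition 2 k l < k \<theta> -
      1.\<close>
    define \<theta> where "\<theta> = l + 1/2"
    have \<theta>: "0 < \<theta>" "\<theta> < 1" using l by (auto simp: \<theta>_def)
    obtain k :: nat where k: "1 / (1/2 - l) < real k" using reals_Archimedean2 by blast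
    have k0: "0 < k" using k l by (intro gr0I) auto
    define D where "D = fact (2 * k) * G.pconst \<theta> ^ (2 * k)"
    define K where "K = D * (2 * R) powr (real k * \<theta>)"
    have D0: "0 \<le> D" using G.pconst_nonneg[OF \<theta>] by (simp add: D_def)
    have mom: "(\<integral>\<^sup>+\<omega>. ennreal (\<bar>V x \<omega> - V y \<omega>\<bar> ^ (2 * k)) \<partial>M)
      \<le> ennreal (K * \<bar>x - y\<bar> powr (1 + (real k * \<theta> - 1)))" for x y
    proof -
      have "(\<integral>\<^sup>+\<omega>. ennreal (\<bar>V x \<omega> - V y \<omega>\<bar> ^ (2 * k)) \<partial>M)
        \<le> ennreal (D * (\<bar>(2 * R * x - R) - (2 * R * y - R)\<bar> powr \<theta>) ^ k)"
        unfolding V_def D_def by (rule G.local_time_moment[OF assms(6) X' \<theta>])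
      also have "\<bar>(2 * R * x - R) - (2 * R * y - R)\<bar> = 2 * R * \<bar>x - y\<bar>"
        using \<open>0 < R\<close> by (simp add: abs_mult right_diff_distrib[symmetric])
      also have "((2 * R * \<bar>x - y\<bar>) powr \<theta>) ^ k = (2 * R) powr (real k * \<theta>) * \<bar>x - y\<bar> powr (real k * \<theta>)"
      proof (cases "x = y")
        case False
        then show ?thesis using \<open>0 < R\<close> by (simp add: powr_power powr_mult power_mult_distrib)
      qed (use k0 in simp)
      finally show ?thesis by (simp add: K_def mult.assoc)
    qed
    have lp: "l * real (2 * k) < real k * \<theta> - 1"
    proof -
      have "1 < real k * (1/2 - l)" using k l by (simp add: field_simps)
      then show ?thesis by (simp add: \<theta>_def algebra_simps)
    qed
    have K0: "0 \<le> K" using D0 by (simp add: K_def)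
    have p0: "0 < 2 * k" using k0 by simp
    note kc = Kolmogorov_Chentsov_unit_interval[OF Vm p0 K0 mom l(1) lp]
    show ?thesis using kc by blast
  qed
  \<comment> \<open>Outside [-R, R] the given version is kept, so that \<open>L'\<close> is a
    modification at every level.\<close>
  define L' where "L' x \<omega> = (if x \<in> {-R..R} then dyadic_limit (\<lambda>z. V z \<omega>) ((x + R) / (2 * R)) else L t x \<omega>)" for x \<omega>
  have unit: "(x + R) / (2 * R) \<in> {0..1}" if "x \<in> {-R..R}" for x
    using that \<open>0 < R\<close> by (auto simp: field_simps)
  have "is_modification M (L t) L'"
    unfolding is_modification_def
  proof (intro allI conjI)
    fix x
    show "L' x \<in> borel_measurable M"
      using Lm dyadic_limit_measurable[of V, OF Vm unit] by (cases "x \<in> {-R..R}") (auto simp: L'_def[abs_def])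
    show "AE \<omega> in M. L' x \<omega> = L t x \<omega>"
    proof (cases "x \<in> {-R..R}")
      case True
      have "V ((x + R) / (2 * R)) = L t x" using \<open>0 < R\<close> by (simp add: V_def)
      \<comment> \<open>This part of the criterion does not involve the exponent; 1/4 is an
        arbitrary choice.\<close>
      moreover have "AE \<omega> in M. dyadic_limit (\<lambda>z. V z \<omega>) ((x + R) / (2 * R)) = V ((x + R) / (2 * R)) \<omega>"
        by (rule bspec[OF conjunct2[OF kc[of "1/4"]]]) (use unit[OF True] in simp_all)
      ultimately show ?thesis using True by (simp add: L'_def)
    qed (auto simp: L'_def)
  qed
  moreover have "\<exists>C :: 'a \<Rightarrow> real. C \<in> borel_measurable M \<and> (AE \<omega> in M. 0 < C \<omega>) \<and>
      (AE \<omega> in M. \<forall>x\<in>{-R..R}. \<forall>y\<in>{-R..R}. \<bar>L' x \<omega> - L' y \<omega>\<bar> \<le> C \<omega> * \<bar>x - y\<bar> powr l)"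
    if l: "0 < l" "l < 1/2" for l
  proof -
    obtain C where C: "C \<in> borel_measurable M" "\<And>\<omega>. 0 < C \<omega>"
      and Cb: "AE \<omega> in M. \<forall>x\<in>{0..1}. \<forall>y\<in>{0..1}.
        \<bar>dyadic_limit (\<lambda>z. V z \<omega>) x - dyadic_limit (\<lambda>z. V z \<omega>) y\<bar> \<le> C \<omega> * \<bar>x - y\<bar> powr l"
      using kc[OF l] by blast
    \<comment> \<open>The factor undoes the rescaling of levels by 2 R.\<close>
    define C' where "C' \<omega> = C \<omega> * (1 / (2 * R)) powr l" for \<omega>
    have "AE \<omega> in M. \<forall>x\<in>{-R..R}. \<forall>y\<in>{-R..R}. \<bar>L' x \<omega> - L' y \<omega>\<bar> \<le> C' \<omega> * \<bar>x - y\<bar> powr l"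
      using Cb
    proof eventually_elim
      case (elim \<omega>)
      show ?case
      proof (intro ballI)
        fix x y assume xy: "x \<in> {-R..R}" "y \<in> {-R..R}"
        have "\<bar>(x + R) / (2 * R) - (y + R) / (2 * R)\<bar> = 1 / (2 * R) * \<bar>x - y\<bar>"
          using \<open>0 < R\<close> by (simp add: diff_divide_distrib[symmetric] abs_divide)
        moreover have "\<bar>L' x \<omega> - L' y \<omega>\<bar> \<le> C \<omega> * \<bar>(x + R) / (2 * R) - (y + R) / (2 * R)\<bar> powr l"
          using elim unit[OF xy(1)] unit[OF xy(2)] xy by (simp add: L'_def)
        ultimately show "\<bar>L' x \<omega> - L' y \<omega>\<bar> \<le> C' \<omega> * \<bar>x - y\<bar> powr l"
          using \<open>0 < R\<close> by (simp only: C'_def powr_mult mult.assoc)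
      qed
    qed
    then show ?thesis using C \<open>0 < R\<close> by (intro exI[of _ C']) (auto simp: C'_def[abs_def])
  qed
  ultimately show ?thesis by blast
qed

end
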